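(* For $n\ge1$, the number of isomorphism classes of micro-macro systems with $n$ microstates equals $$\sum_{k=1}^{n}\ \sum_{l\in\mathrm{par}_k(n)}\ \sum_{\pi\in\mathrm{Par}[k]}\ \prod_{c\in\pi}\sigma(c),\qquad\text{where } g_c=\gcd\{l_i: i\in c\},\quad \sigma(c)=\sum_{d\mid g_c} d^{|c|-1}.$$
   Context: A micro-macro system $(X,A,m,\alpha)$ consists of finite sets $X$ (microstates) and $A$ (macrostates), a bijection $\alpha:X\to X$ and a surjection $m:X\to A$. Two systems $(X_1,A_1,m_1,\alpha_1)$ and $(X_2,A_2,m_2,\alpha_2)$ are isomorphic if there is a bijection $\beta:X_1\to X_2$ with $\alpha_2=\beta\alpha_1\beta^{-1}$ which induces a map $\widehat\beta:A_1\to A_2$ with $\widehat\beta m_1=m_2\beta$. $\mathrm{par}_k(n)$ is the set of sequences $l=(l_1,\dots,l_k)$ of positive integers with $l_1\ge\cdots\ge l_k$ and $\sum l_i=n$ (the cycle lengths of a permutation with $k$ cycles), and $\mathrm{Par}[k]$ is the set of set partitions of $[k]=\{1,\dots,k\}$; $|c|$ is the size of the block $c$.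
   Formalization: In the definition of isomorphism the induced map on macrostates is required to be a bijection; with an arbitrary induced map the relation is not symmetric and the count already fails for n = 2. *)

theory Defs
  imports Main "HOL-Library.Disjoint_Sets" "HOL-Library.Infinite_Typeclass"
begin

text \<open>The values of \<open>proj\<close> and \<open>dyn\<close> outside the set of microstates are irrelevant: systems that
  differ only there are isomorphic.\<close>

record ('x, 'a) micro_macro =
  micro :: "'x set"
  macro :: "'a set"
  proj :: "'x \<Rightarrow> 'a"
  dyn :: "'x \<Rightarrow> 'x"

definition micro_macro_system :: "('x, 'a) micro_macro \<Rightarrow> bool" where
  "micro_macro_system S \<longleftrightarrow>
     finite (micro S) \<and> finite (macro S) \<and>
     bij_betw (dyn S) (micro S) (micro S) \<and> proj S ` micro S = macro S"

text \<open>The induced map on macrostates is required to be a bijection. If it were an arbitrary map, the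
  relation would not be symmetric (every system would be related to the one that identifies all its
  macrostates), and there would be no isomorphism classes to speak of.\<close>

definition micro_macro_iso :: "('x, 'a) micro_macro \<Rightarrow> ('y, 'b) micro_macro \<Rightarrow> bool" where
  "micro_macro_iso S T \<longleftrightarrow>
     (\<exists>\<beta>. bij_betw \<beta> (micro S) (micro T) \<and>
          (\<forall>y\<in>micro T. dyn T y = \<beta> (dyn S (inv_into (micro S) \<beta> y))) \<and>
          (\<exists>\<beta>'. bij_betw \<beta>' (macro S) (macro T) \<and>
                (\<forall>x\<in>micro S. \<beta>' (proj S x) = proj T (\<beta> x))))"

definition micro_macro_systems :: "nat \<Rightarrow> ('x, 'a) micro_macro set" where
  "micro_macro_systems n = {S. micro_macro_system S \<and> card (micro S) = n}"

definition micro_macro_iso_rel :: "nat \<Rightarrow> ('x, 'a) micro_macro rel" where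
  "micro_macro_iso_rel n =
     {(S, T). S \<in> micro_macro_systems n \<and> T \<in> micro_macro_systems n \<and> micro_macro_iso S T}"

definition par :: "nat \<Rightarrow> nat \<Rightarrow> nat list set" where
  "par k n = {l. length l = k \<and> (\<forall>x\<in>set l. 0 < x) \<and> sorted_wrt (\<ge>) l \<and> sum_list l = n}"

definition Par :: "nat \<Rightarrow> nat set set set" where
  "Par k = {\<pi>. partition_on {1..k} \<pi>}"

text \<open>Blocks contain indices counted from 1, list positions are counted from 0.\<close>

definition block_gcd :: "nat list \<Rightarrow> nat set \<Rightarrow> nat" where
  "block_gcd l c = Gcd {l ! (i - 1) | i. i \<in> c}"

definition block_sigma :: "nat list \<Rightarrow> nat set \<Rightarrow> nat" where
  "block_sigma l c = (\<Sum>d | d dvd block_gcd l c. d ^ (card c - 1))"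

lemma micro_macro_iso_refl:
  assumes "micro_macro_system S"
  shows "micro_macro_iso S S"
  unfolding micro_macro_iso_def
proof (intro exI[of _ id] conjI)
  show "\<forall>y\<in>micro S. dyn S y = id (dyn S (inv_into (micro S) id y))"
    by (simp add: inv_into_f_f[of id, simplified])
qed auto

lemma micro_macro_iso_alt:
  assumes "micro_macro_system S" "micro_macro_system T"
  shows "micro_macro_iso S T \<longleftrightarrow>
     (\<exists>\<beta> \<beta>'. bij_betw \<beta> (micro S) (micro T) \<and> (\<forall>x\<in>micro S. dyn T (\<beta> x) = \<beta> (dyn S x)) \<and>
       bij_betw \<beta>' (macro S) (macro T) \<and> (\<forall>x\<in>micro S. \<beta>' (proj S x) = proj T (\<beta> x)))"
proof -
  have "(\<forall>y\<in>micro T. dyn T y = \<beta> (dyn S (inv_into (micro S) \<beta> y))) \<longleftrightarrow>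
        (\<forall>x\<in>micro S. dyn T (\<beta> x) = \<beta> (dyn S x))"
    if "bij_betw \<beta> (micro S) (micro T)" for \<beta>
  proof -
    have T_eq: "micro T = \<beta> ` micro S"
      and "\<And>x. x \<in> micro S \<Longrightarrow> inv_into (micro S) \<beta> (\<beta> x) = x"
      using that by (auto simp: bij_betw_def inv_into_f_f)
    then show ?thesis
      unfolding T_eq by simp
  qed
  then show ?thesis
    unfolding micro_macro_iso_def by blast
qed

lemma micro_macro_iso_sym:
  assumes S: "micro_macro_system S" and T: "micro_macro_system T" and iso: "micro_macro_iso S T"
  shows "micro_macro_iso T S"
proof -
  obtain b b' where b: "bij_betw b (micro S) (micro T)" "\<forall>x\<in>micro S. dyn T (b x) = b (dyn S x)"
    and b': "bij_betw b' (macro S) (macro T)" "\<forall>x\<in>micro S. b' (proj S x) = proj T (b x)"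
    using iso micro_macro_iso_alt[OF S T] by blast
  let ?c = "inv_into (micro S) b" and ?c' = "inv_into (macro S) b'"
  have dS: "dyn S x \<in> micro S" "proj S x \<in> macro S" if "x \<in> micro S" for x
    using S that by (auto simp: micro_macro_system_def bij_betw_def)
  have "dyn S (?c y) = ?c (dyn T y) \<and> ?c' (proj T y) = proj S (?c y)" if y: "y \<in> micro T" for y
  proof -
    obtain x where x: "x \<in> micro S" "y = b x"
      using y bij_betw_imp_surj_on[OF b(1)] by blast
    have "?c (dyn T (b x)) = dyn S x"
      unfolding b(2)[rule_format, OF x(1)] using bij_betw_inv_into_left[OF b(1) dS(1)[OF x(1)]] .
    moreover have "?c' (proj T (b x)) = proj S x"
      unfolding b'(2)[rule_format, OF x(1), symmetric] using bij_betw_inv_into_left[OF b'(1) dS(2)[OF x(1)]] .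
    moreover have "?c (b x) = x"
      using b(1) x(1) by (rule bij_betw_inv_into_left)
    ultimately show ?thesis using x by simp
  qed
  then show ?thesis
    unfolding micro_macro_iso_alt[OF T S]
    using bij_betw_inv_into[OF b(1)] bij_betw_inv_into[OF b'(1)] by blast
qed

lemma micro_macro_iso_trans:
  assumes S: "micro_macro_system S" and T: "micro_macro_system T" and U: "micro_macro_system U"
    and iso: "micro_macro_iso S T" "micro_macro_iso T U"
  shows "micro_macro_iso S U"
proof -
  obtain b b' where b: "bij_betw b (micro S) (micro T)" "\<forall>x\<in>micro S. dyn T (b x) = b (dyn S x)"
    and b': "bij_betw b' (macro S) (macro T)" "\<forall>x\<in>micro S. b' (proj S x) = proj T (b x)"
    using iso(1) micro_macro_iso_alt[OF S T] by blast
  obtain c c' where c: "bij_betw c (micro T) (micro U)" "\<forall>x\<in>micro T. dyn U (c x) = c (dyn T x)"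
    and c': "bij_betw c' (macro T) (macro U)" "\<forall>x\<in>micro T. c' (proj T x) = proj U (c x)"
    using iso(2) micro_macro_iso_alt[OF T U] by blast
  have "b x \<in> micro T" if "x \<in> micro S" for x
    using b(1) that by (auto simp: bij_betw_def)
  then have "\<forall>x\<in>micro S. dyn U ((c \<circ> b) x) = (c \<circ> b) (dyn S x)"
    and "\<forall>x\<in>micro S. (c' \<circ> b') (proj S x) = proj U ((c \<circ> b) x)"
    using b c b' c' by auto
  then show ?thesis
    unfolding micro_macro_iso_alt[OF S U]
    using bij_betw_trans[OF b(1) c(1)] bij_betw_trans[OF b'(1) c'(1)] by blast
qed

lemma equiv_micro_macro_iso_rel:
  "equiv (micro_macro_systems n :: ('x, 'a) micro_macro set) (micro_macro_iso_rel n)"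
  (is "equiv ?A ?r")
proof (rule equivI)
  show "?r \<subseteq> ?A \<times> ?A"
    by (auto simp: micro_macro_iso_rel_def)
  show "refl_on ?A ?r"
    by (auto simp: refl_on_def micro_macro_iso_rel_def micro_macro_systems_def micro_macro_iso_refl)
  show "sym ?r"
    unfolding sym_def micro_macro_iso_rel_def micro_macro_systems_def mem_Collect_eq prod.case
    using micro_macro_iso_sym by blast
  show "trans ?r"
  proof (rule transI)
    fix S T U :: "('x, 'a) micro_macro"
    assume "(S, T) \<in> ?r" "(T, U) \<in> ?r"
    then show "(S, U) \<in> ?r"
      using micro_macro_iso_trans[of S T U]
      by (simp add: micro_macro_iso_rel_def micro_macro_systems_def)
  qed
qed

lemma finite_par: "finite (par k n)"
proof (rule finite_subset)
  show "par k n \<subseteq> {l. set l \<subseteq> {..n} \<and> length l = k}"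
    by (auto simp: par_def member_le_sum_list)
qed (simp add: finite_lists_length_eq)

lemma finite_Par: "finite (Par k)"
proof (rule finite_subset)
  show "Par k \<subseteq> Pow (Pow {1..k})"
    by (auto simp: Par_def partition_on_def)
qed simp

end

theory Submission
  imports Defs "HOL-Combinatorics.Cycles" "HOL-Combinatorics.Orbits"
begin

text \<open>A system with \<open>n\<close> microstates is, up to the names of its macrostates, a pair of a permutation
  \<open>\<alpha>\<close> and an equivalence relation \<open>E\<close> on a fixed set \<open>X\<close> of size \<open>n\<close>; isomorphism classes are the
  orbits of \<open>Sym X\<close> on such pairs. By Burnside's lemma their number times \<open>n!\<close> is the sum over \<open>g\<close> of
  \<open>|Z g| F g\<close>, where \<open>Z g\<close> is the centralizer of \<open>g\<close> and \<open>F g\<close> the number of \<open>g\<close>-invariant equivalence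
  relations. The conjugacy class of \<open>g\<close> has \<open>n! / |Z g|\<close> elements, so the number of orbits is the sum of
  \<open>F\<close> over conjugacy classes, i.e. over cycle types \<open>l\<close>. Thus \<open>l\<close> is the cycle type of the relabelling
  permutation \<open>g\<close>, not of the dynamics \<open>\<alpha>\<close>; the terms for a single \<open>l\<close> do not count the systems whose
  dynamics has cycle type \<open>l\<close>.

  An invariant equivalence relation partitions the cycles of \<open>g\<close> into groups that meet common
  classes. The classes meeting a group \<open>c\<close> are permuted cyclically, their number \<open>d\<close> divides all
  cycle lengths in \<open>c\<close>, and the relation on \<open>c\<close> is determined by \<open>d\<close> and the offsets modulo \<open>d\<close> of the
  other cycles relative to one of them, which leaves \<open>d ^ (|c| - 1)\<close> choices.\<close>

section \<open>Equivalence relations invariant under a rotation of rows\<close>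

definition inv_equivs :: "'a set \<Rightarrow> ('a \<Rightarrow> 'a) \<Rightarrow> 'a rel set" where
  "inv_equivs X f = {E. equiv X E \<and> (\<forall>x\<in>X. \<forall>y\<in>X. (f x, f y) \<in> E \<longleftrightarrow> (x, y) \<in> E)}"

text \<open>Standard model of a permutation with one cycle of length \<open>L i\<close> for each
  \<open>i\<close> in \<open>I\<close>; with pairs as points, a rotation becomes arithmetic modulo
  \<open>L i\<close>.\<close>

definition rows :: "nat set \<Rightarrow> (nat \<Rightarrow> nat) \<Rightarrow> (nat \<times> nat) set" where
  "rows I L = (SIGMA i:I. {..<L i})"

definition rotate_rows :: "(nat \<Rightarrow> nat) \<Rightarrow> nat \<times> nat \<Rightarrow> nat \<times> nat" where
  "rotate_rows L = (\<lambda>(i, a). (i, Suc a mod L i))"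

text \<open>The case in which all rows form a single group. These pieces are what the factor
  \<open>block_sigma l c\<close> counts, and every invariant relation is a disjoint union of
  them.\<close>

definition connected_equivs :: "nat set \<Rightarrow> (nat \<Rightarrow> nat) \<Rightarrow> (nat \<times> nat) rel set" where
  "connected_equivs c L = {E \<in> inv_equivs (rows c L) (rotate_rows L).
     \<forall>i\<in>c. \<forall>j\<in>c. \<exists>a b. ((i, a), (j, b)) \<in> E}"

text \<open>The class of position \<open>a\<close> in row \<open>i\<close> is \<open>a + t i\<close> modulo \<open>d\<close>. Only differences of the values of
  \<open>t\<close> matter, so \<open>offsets\<close> normalises \<open>t\<close> to vanish at the least row.\<close>

definition offset_equiv :: "(nat \<Rightarrow> nat) \<Rightarrow> nat set \<Rightarrow> nat \<Rightarrow> (nat \<Rightarrow> nat) \<Rightarrow> (nat \<times> nat) rel" where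
  "offset_equiv L c d t = {((i, a), (j, b)). i \<in> c \<and> j \<in> c \<and> a < L i \<and> b < L j \<and>
     (a + t i) mod d = (b + t j) mod d}"

definition offsets :: "(nat \<Rightarrow> nat) \<Rightarrow> nat set \<Rightarrow> (nat \<times> (nat \<Rightarrow> nat)) set" where
  "offsets L c = (SIGMA d:{d. d dvd Gcd (L ` c)}. PiE c (\<lambda>i. if i = Min c then {0} else {..<d}))"

lemma mem_rows [simp]: "(i, a) \<in> rows I L \<longleftrightarrow> i \<in> I \<and> a < L i"
  by (simp add: rows_def)

lemma finite_rows: "finite I \<Longrightarrow> finite (rows I L)"
  by (simp add: rows_def)

lemma rotate_rows_simp [simp]: "rotate_rows L (i, a) = (i, Suc a mod L i)"
  by (simp add: rotate_rows_def)

lemma finite_inv_equivs: "finite X \<Longrightarrow> finite (inv_equivs X f)"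
  by (rule finite_subset[of _ "Pow (X \<times> X)"]) (auto simp: inv_equivs_def equiv_def)

text \<open>Invariance, iterated, rotates both ends of a pair at once. Reducing each position modulo
  its row length lets \<open>a\<close>, \<open>b\<close> and \<open>m\<close> be arbitrary, so that
  \<open>E\<close> can be studied as a relation on \<open>nat\<close>.\<close>

lemma inv_equivs_rows_shift:
  assumes "E \<in> inv_equivs (rows I L) (rotate_rows L)" "i \<in> I" "j \<in> I" "0 < L i" "0 < L j"
  shows "((i, (a + m) mod L i), (j, (b + m) mod L j)) \<in> E \<longleftrightarrow> ((i, a mod L i), (j, b mod L j)) \<in> E"
proof (induction m)
  case (Suc m)
  let ?x = "(i, (a + m) mod L i)" and ?y = "(j, (b + m) mod L j)"
  have "(rotate_rows L ?x, rotate_rows L ?y) \<in> E \<longleftrightarrow> (?x, ?y) \<in> E"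
    using assms unfolding inv_equivs_def by (simp del: rotate_rows_simp)
  with Suc show ?case
    by (simp add: mod_Suc_eq)
qed simp

text \<open>As for subgroups of the integers: \<open>d\<close> is the least positive number related
  to 0. Shifts relate all its multiples to 0, and a number related to 0 leaves a remainder related
  to 0, which vanishes by minimality.\<close>

lemma shift_invariant_equiv_nat:
  fixes q :: "nat \<Rightarrow> nat \<Rightarrow> bool"
  assumes refl: "\<And>a. q a a" and sym: "\<And>a b. q a b \<Longrightarrow> q b a"
    and trans: "\<And>a b c. q a b \<Longrightarrow> q b c \<Longrightarrow> q a c"
    and shift: "\<And>a b m. q (a + m) (b + m) \<longleftrightarrow> q a b" and N: "0 < N" "q 0 N"
  obtains d where "0 < d" "\<And>a b. q a b \<longleftrightarrow> a mod d = b mod d"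
proof -
  define d where "d = (LEAST m. 0 < m \<and> q 0 m)"
  have d: "0 < d" "q 0 d"
    using LeastI[of "\<lambda>m. 0 < m \<and> q 0 m" N] N unfolding d_def by auto
  have least: "m = 0" if "m < d" "q 0 m" for m
    using not_less_Least[of m "\<lambda>m. 0 < m \<and> q 0 m"] that unfolding d_def by auto
  have mult: "q 0 (d * k)" for k
  proof (induction k)
    case (Suc k)
    have "q (0 + d) (d * k + d)"
      using Suc shift by blast
    with d(2) trans[of 0 d] show ?case
      by (simp add: add.commute)
  qed (simp add: refl)
  have dvd: "q 0 m \<longleftrightarrow> d dvd m" for m
  proof
    assume m: "q 0 m"
    have "q (0 + m mod d) (d * (m div d) + m mod d)"
      using mult shift by blast
    then have "q (m mod d) m"
      by simp
    with m sym trans have "q 0 (m mod d)"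
      by blast
    with least d(1) show "d dvd m"
      by (meson mod_0_imp_dvd mod_less_divisor)
  qed (use mult in auto)
  have *: "q a b \<longleftrightarrow> a mod d = b mod d" if "a \<le> b" for a b
    using shift[of 0 a "b - a"] dvd[of "b - a"] mod_eq_dvd_iff_nat[OF that, of d] that by auto
  have "q a b \<longleftrightarrow> a mod d = b mod d" for a b
  proof (cases a b rule: le_cases)
    case le
    then show ?thesis
      by (rule *)
  next
    case ge
    have "q a b \<longleftrightarrow> q b a"
      using sym by blast
    with *[OF ge] show ?thesis
      by metis
  qed
  with d(1) that show ?thesis
    by blast
qed

text \<open>Since \<open>d\<close> divides each row length, wrapping around a row does not change
  residues modulo \<open>d\<close>, and a rotation adds 1 to the residue of every position.\<close>

lemma offset_equiv_connected:
  assumes d: "d dvd Gcd (L ` c)" and pos: "\<And>i. i \<in> c \<Longrightarrow> 0 < L i" and t: "\<And>i. i \<in> c \<Longrightarrow> t i < d"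
  shows "offset_equiv L c d t \<in> connected_equivs c L"
proof -
  have dL: "d dvd L i" if "i \<in> c" for i
    using d that by (meson Gcd_dvd dvd_trans imageI)
  have "equiv (rows c L) (offset_equiv L c d t)"
    by (rule equivI)
      (auto simp: offset_equiv_def refl_on_def sym_def trans_def)
  moreover have "(rotate_rows L (i, a), rotate_rows L (j, b)) \<in> offset_equiv L c d t
      \<longleftrightarrow> ((i, a), (j, b)) \<in> offset_equiv L c d t" if "i \<in> c" "j \<in> c" "a < L i" "b < L j" for i j a b
  proof -
    have *: "(Suc x mod L k + t k) mod d = Suc (x + t k) mod d" if "k \<in> c" for x k
      using mod_mod_cancel[OF dL[OF that], of "Suc x"] by (metis add_Suc mod_add_left_eq)
    have "Suc (a + t i) mod d = Suc (b + t j) mod d \<longleftrightarrow> (a + t i) mod d = (b + t j) mod d"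
      by (auto simp: mod_Suc)
    with that pos show ?thesis
      by (simp add: offset_equiv_def *)
  qed
  moreover have "\<exists>a b. ((i, a), (j, b)) \<in> offset_equiv L c d t" if "i \<in> c" "j \<in> c" for i j
  proof -
    \<comment> \<open>Every row has a position of class 0, so any two rows share that class. The
      outer \<open>mod d\<close> covers \<open>t k = 0\<close>.\<close>
    have "(d - t k) mod d < L k \<and> ((d - t k) mod d + t k) mod d = 0" if "k \<in> c" for k
    proof -
      have "(d - t k) mod d < d" "d \<le> L k"
        using t[OF that] dL pos that by (simp_all add: dvd_imp_le)
      then have "(d - t k) mod d < L k"
        by linarith
      moreover have "((d - t k) mod d + t k) mod d = (d - t k + t k) mod d"
        by (rule mod_add_left_eq)
      ultimately show ?thesis
        using t[OF that] by simp
    qed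
    with that show ?thesis
      unfolding offset_equiv_def by force
  qed
  ultimately show ?thesis
    by (auto simp: connected_equivs_def inv_equivs_def rows_def simp del: rotate_rows_simp)
qed

text \<open>On the base row \<open>Min c\<close> the relation is congruence modulo some
  \<open>d\<close>. One pair linking row \<open>i\<close> to the base row yields the others by
  rotation, so a single offset per row determines \<open>E\<close>.\<close>

lemma connected_equivE:
  assumes c: "finite c" "c \<noteq> {}" and pos: "\<And>i. i \<in> c \<Longrightarrow> 0 < L i" and E: "E \<in> connected_equivs c L"
  obtains d t where "(d, t) \<in> offsets L c" "E = offset_equiv L c d t"
proof -
  define z where "z = Min c"
  have z: "z \<in> c"
    using c by (simp add: z_def)
  have inv: "E \<in> inv_equivs (rows c L) (rotate_rows L)"
    and conn: "\<And>i j. i \<in> c \<Longrightarrow> j \<in> c \<Longrightarrow> \<exists>a b. ((i, a), (j, b)) \<in> E"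
    using E by (auto simp: connected_equivs_def)
  have eq: "equiv (rows c L) E"
    using inv by (simp add: inv_equivs_def)
  have sub: "E \<subseteq> rows c L \<times> rows c L" and sym: "\<And>x y. (x, y) \<in> E \<Longrightarrow> (y, x) \<in> E"
    and trans: "\<And>x y z. (x, y) \<in> E \<Longrightarrow> (y, z) \<in> E \<Longrightarrow> (x, z) \<in> E"
    and refl: "\<And>x. x \<in> rows c L \<Longrightarrow> (x, x) \<in> E"
    using eq by (auto simp: equiv_def refl_on_def dest: symD transD)
  note shift = inv_equivs_rows_shift[OF inv _ _ pos pos]
  \<comment> \<open>\<open>E\<close> on the base row, unrolled to all natural numbers; a full turn
    gives \<open>q 0 (L z)\<close>.\<close>
  define q where "q a b \<longleftrightarrow> ((z, a mod L z), (z, b mod L z)) \<in> E" for a b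
  obtain d where d: "0 < d" "\<And>a b. q a b \<longleftrightarrow> a mod d = b mod d"
  proof (rule shift_invariant_equiv_nat[of q "L z"])
    show "q (a + m) (b + m) \<longleftrightarrow> q a b" for a b m
      unfolding q_def using shift[OF z z z z] .
    show "q a b \<Longrightarrow> q b a" for a b
      unfolding q_def by (rule sym)
    show "q a b \<Longrightarrow> q b e \<Longrightarrow> q a e" for a b e
      unfolding q_def by (rule trans)
  qed (use z pos refl in \<open>auto simp: q_def\<close>)
  \<comment> \<open>Rotating a link by \<open>L i - b\<close> moves its end in row \<open>i\<close>
    to position 0.\<close>
  have "\<exists>s. ((z, s mod L z), (i, 0 mod L i)) \<in> E" if i: "i \<in> c" for i
  proof -
    obtain a b where ab: "((z, a), (i, b)) \<in> E"
      using conn z i by blast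
    then have lt: "a < L z" "b < L i"
      using sub by auto
    with ab have "((z, (a + (L i - b)) mod L z), (i, (b + (L i - b)) mod L i)) \<in> E"
      unfolding shift[OF z i z i] by simp
    with lt show ?thesis
      by auto
  qed
  then obtain s where s: "\<And>i. i \<in> c \<Longrightarrow> ((z, s i mod L z), (i, 0 mod L i)) \<in> E"
    by metis
  \<comment> \<open>The base-row position, modulo \<open>d\<close>, that shares a class with
    position 0 of row \<open>i\<close>; undefined off \<open>c\<close>, as \<open>PiE\<close>
    requires.\<close>
  define t where "t = (\<lambda>i\<in>c. s i mod d)"
  have link: "((i, a mod L i), (z, (a + t i) mod L z)) \<in> E" if i: "i \<in> c" for i a
  proof -
    have "q (t i) (s i)"
      using i d(2) by (simp add: t_def)
    then have "((z, t i mod L z), (i, 0 mod L i)) \<in> E"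
      unfolding q_def using s[OF i] trans by blast
    then have "((z, (t i + a) mod L z), (i, (0 + a) mod L i)) \<in> E"
      unfolding shift[OF z i z i] .
    then show ?thesis
      using sym by (simp add: add.commute)
  qed
  have iff: "((i, a mod L i), (j, b mod L j)) \<in> E \<longleftrightarrow> (a + t i) mod d = (b + t j) mod d"
    if "i \<in> c" "j \<in> c" for i j a b
    unfolding d(2)[symmetric] q_def using link[OF that(1), of a] link[OF that(2), of b] sym trans by blast
  \<comment> \<open>A full turn of row \<open>i\<close> returns to the same position, so adding
    \<open>L i\<close> must not change the residue.\<close>
  have "d dvd L i" if i: "i \<in> c" for i
  proof -
    have "((i, L i mod L i), (i, 0 mod L i)) \<in> E"
      using i pos refl by simp
    then have "(L i + t i) mod d = (0 + t i) mod d"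
      using iff i by blast
    then show ?thesis
      by (metis add.commute add_0 add_diff_cancel_left' le_add1 mod_eq_dvd_iff_nat)
  qed
  then have "d dvd Gcd (L ` c)"
    by (auto intro: Gcd_greatest)
  moreover have "t z = 0"
  proof -
    have "q (s z) 0"
      unfolding q_def using s[OF z] .
    then show ?thesis
      using d z by (simp add: t_def)
  qed
  ultimately have "(d, t) \<in> offsets L c"
    using d(1) by (auto simp: offsets_def z_def t_def)
  moreover have "E = offset_equiv L c d t"
  proof (intro set_eqI iffI; clarify)
    fix i a j b assume ab: "((i, a), (j, b)) \<in> E"
    then have "i \<in> c" "j \<in> c" "a < L i" "b < L j"
      using sub by auto
    with ab iff[of i j a b] show "((i, a), (j, b)) \<in> offset_equiv L c d t"
      by (simp add: offset_equiv_def)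
  next
    fix i a j b assume "((i, a), (j, b)) \<in> offset_equiv L c d t"
    with iff[of i j a b] show "((i, a), (j, b)) \<in> E"
      by (simp add: offset_equiv_def)
  qed
  ultimately show ?thesis
    using that by blast
qed

lemma offsetsD:
  assumes c: "finite c" "c \<noteq> {}" and pos: "\<And>i. i \<in> c \<Longrightarrow> 0 < L i" and dt: "(d, t) \<in> offsets L c"
  shows "d dvd Gcd (L ` c)" "\<And>i. i \<in> c \<Longrightarrow> t i < d" "t (Min c) = 0" "t \<in> extensional c"
    "\<And>i. i \<in> c \<Longrightarrow> d dvd L i" "0 < d"
proof -
  show d: "d dvd Gcd (L ` c)" and "t \<in> extensional c"
    using dt by (auto simp: offsets_def PiE_def)
  have t: "t i \<in> (if i = Min c then {0} else {..<d})" if "i \<in> c" for i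
    using dt that unfolding offsets_def by (blast dest: PiE_mem)
  from t[of "Min c"] c show "t (Min c) = 0"
    by simp
  show dL: "d dvd L i" if "i \<in> c" for i
    using d that by (meson Gcd_dvd dvd_trans imageI)
  show "0 < d"
    using c pos dL by (metis all_not_in_conv dvd_0_left_iff gr0I less_irrefl)
  with t show "t i < d" if "i \<in> c" for i
    using that by (metis lessThan_iff singletonD)
qed

text \<open>Both parameters can be read off the relation: \<open>d\<close> from the base-row
  positions related to position 0, and \<open>t i\<close> from the base-row position below
  \<open>d\<close> related to position 0 of row \<open>i\<close>.\<close>

lemma offset_equiv_inj_on:
  assumes c: "finite c" "c \<noteq> {}" and pos: "\<And>i. i \<in> c \<Longrightarrow> 0 < L i"
  shows "inj_on (\<lambda>(d, t). offset_equiv L c d t) (offsets L c)"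
proof (rule inj_onI, clarify)
  fix d t d' t'
  assume dt: "(d, t) \<in> offsets L c" "(d', t') \<in> offsets L c"
    and eq: "offset_equiv L c d t = offset_equiv L c d' t'"
  define z where "z = Min c"
  have z: "z \<in> c"
    using c by (simp add: z_def)
  note D = offsetsD[OF c pos dt(1), simplified, folded z_def] and D' = offsetsD[OF c pos dt(2), simplified, folded z_def]
  have mem: "(a + t i) mod d = (b + t j) mod d \<longleftrightarrow> (a + t' i) mod d' = (b + t' j) mod d'"
    if "i \<in> c" "j \<in> c" "a < L i" "b < L j" for a b i j
    using eq that by (auto simp: offset_equiv_def set_eq_iff)
  have le: "d \<le> L z" "d' \<le> L z"
    using D(5)[OF z] D'(5)[OF z] pos[OF z] by (auto simp: dvd_imp_le)
  have "d' dvd d"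
    \<comment> \<open>Position \<open>d\<close> of the base row, related to position 0, exists only
      if \<open>d < L z\<close>; if \<open>d = L z\<close>, then \<open>d'\<close> divides
      \<open>d\<close> because it divides \<open>L z\<close>.\<close>
    using mem[OF z z, of d 0] D(3) D'(3) le D'(5)[OF z] pos[OF z] by (cases "d = L z") auto
  moreover have "d dvd d'"
    using mem[OF z z, of d' 0] D(3) D'(3) le D(5)[OF z] pos[OF z] by (cases "d' = L z") auto
  ultimately have dd: "d = d'"
    by (rule dvd_antisym[symmetric])
  have "t i = t' i" if "i \<in> c" for i
    using mem[OF z that, of "t i" 0] D(2)[OF that] D'(2)[OF that] D(3) D'(3) le pos[OF that] dd by simp
  then have "t = t'"
    using D(4) D'(4) by (rule extensionalityI[rotated 2])
  with dd show "d = d' \<and> t = t'"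
    by simp
qed

lemma card_connected_equivs:
  assumes c: "finite c" "c \<noteq> {}" and pos: "\<And>i. i \<in> c \<Longrightarrow> 0 < L i"
  shows "card (connected_equivs c L) = (\<Sum>d | d dvd Gcd (L ` c). d ^ (card c - 1))"
proof -
  have "(\<lambda>(d, t). offset_equiv L c d t) ` offsets L c = connected_equivs c L"
  proof
    show "(\<lambda>(d, t). offset_equiv L c d t) ` offsets L c \<subseteq> connected_equivs c L"
    proof clarify
      fix d t assume "(d, t) \<in> offsets L c"
      note D = offsetsD[OF c pos this]
      show "offset_equiv L c d t \<in> connected_equivs c L"
        by (rule offset_equiv_connected) (use D pos in auto)
    qed
    show "connected_equivs c L \<subseteq> (\<lambda>(d, t). offset_equiv L c d t) ` offsets L c"
      by (rule subsetI, rule connected_equivE[OF c pos]) auto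
  qed
  then have "card (connected_equivs c L) = card (offsets L c)"
    using card_image[OF offset_equiv_inj_on[OF c pos]] by force
  also have "\<dots> = (\<Sum>d | d dvd Gcd (L ` c). d ^ (card c - 1))"
  proof -
    have "Gcd (L ` c) \<noteq> 0"
      by (metis Gcd_0_iff all_not_in_conv c(2) image_subset_iff less_irrefl pos singletonD)
    then have "finite {d. d dvd Gcd (L ` c)}"
      by (simp only: finite_divisors_nat gr0I)
    \<comment> \<open>The normalised row \<open>Min c\<close> leaves one choice and each other row
      \<open>d\<close>, whence the exponent.\<close>
    moreover have "card (PiE c (\<lambda>i. if i = Min c then {0} else {..<d})) = d ^ (card c - 1)" for d
    proof -
      have "(\<Prod>i\<in>c. card (if i = Min c then {0} else {..<d})) = (\<Prod>i\<in>c - {Min c}. d)"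
        using c by (subst prod.remove[of c "Min c"]) (auto intro!: prod.cong)
      then show ?thesis
        using c by (simp add: card_PiE)
    qed
    ultimately show ?thesis
      using c unfolding offsets_def by (subst card_SigmaI) (auto intro!: finite_PiE split: if_splits)
  qed
  finally show ?thesis .
qed


section \<open>Splitting an invariant relation into groups of linked rows\<close>

definition row_rel :: "(nat \<times> nat) rel \<Rightarrow> nat rel" where
  "row_rel E = {(i, j). \<exists>a b. ((i, a), (j, b)) \<in> E}"

lemma connected_equivsD:
  assumes "E \<in> connected_equivs c L"
  shows "E \<subseteq> rows c L \<times> rows c L" "\<And>x. x \<in> rows c L \<Longrightarrow> (x, x) \<in> E" "sym E" "trans E"
    "\<And>x y. x \<in> rows c L \<Longrightarrow> y \<in> rows c L \<Longrightarrow> (rotate_rows L x, rotate_rows L y) \<in> E \<longleftrightarrow> (x, y) \<in> E"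
    "\<And>i j. i \<in> c \<Longrightarrow> j \<in> c \<Longrightarrow> (i, j) \<in> row_rel E"
  using assms by (auto simp: connected_equivs_def inv_equivs_def equiv_def refl_on_def row_rel_def
      simp del: rotate_rows_simp)

text \<open>Gluing loses nothing: rows of different blocks are never related while any two rows of
  one block are, so the blocks come back as classes of linked rows, and the pieces by
  restriction.\<close>

lemma Union_connected_equivs:
  assumes \<pi>: "partition_on I \<pi>" and f: "\<And>c. c \<in> \<pi> \<Longrightarrow> f c \<in> connected_equivs c L"
  defines "E \<equiv> \<Union>c\<in>\<pi>. f c"
  shows "E \<in> inv_equivs (rows I L) (rotate_rows L)" "I // row_rel E = \<pi>"
    "\<And>c. c \<in> \<pi> \<Longrightarrow> E \<inter> (rows c L \<times> rows c L) = f c"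
proof -
  note f = connected_equivsD[OF f]
  have blocks: "I = \<Union>\<pi>" "\<And>c c' i. c \<in> \<pi> \<Longrightarrow> c' \<in> \<pi> \<Longrightarrow> i \<in> c \<Longrightarrow> i \<in> c' \<Longrightarrow> c = c'"
    using \<pi> by (auto simp: partition_on_def disjoint_def)
  \<comment> \<open>Blocks are disjoint, so a pair that starts in a row of \<open>c\<close> can only
    stem from the piece on \<open>c\<close>.\<close>
  have key: "((i, a), y) \<in> E \<longleftrightarrow> ((i, a), y) \<in> f c" if c: "c \<in> \<pi>" "i \<in> c" for c i a y
  proof
    assume "((i, a), y) \<in> E"
    then obtain c' where c': "c' \<in> \<pi>" "((i, a), y) \<in> f c'"
      by (auto simp: E_def)
    then have "i \<in> c'"
      using f(1) by fastforce
    with c c' blocks(2) show "((i, a), y) \<in> f c"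
      by metis
  qed (use c in \<open>auto simp: E_def\<close>)
  show restr: "E \<inter> (rows c L \<times> rows c L) = f c" if "c \<in> \<pi>" for c
    using f(1)[OF that] key[OF that] by auto
  have "equiv (rows I L) E"
  proof (rule equivI)
    show "E \<subseteq> rows I L \<times> rows I L"
      using f(1) unfolding E_def blocks(1) rows_def by blast
    show "refl_on (rows I L) E"
      using f(2) blocks(1) by (fastforce simp: refl_on_def E_def)
    show "sym E"
      unfolding E_def using f(3) by (auto intro!: symI dest: symD)
    show "trans E"
    proof (rule transI)
      fix x y z assume xy: "(x, y) \<in> E" and yz: "(y, z) \<in> E"
      from xy obtain c where c: "c \<in> \<pi>" "(x, y) \<in> f c"
        by (auto simp: E_def)
      with yz f(1)[OF c(1)] key[OF c(1), of "fst y" "snd y" z] have "(y, z) \<in> f c"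
        by (cases y) auto
      with c f(4) show "(x, z) \<in> E"
        unfolding E_def by (blast dest: transD)
    qed
  qed
  moreover have "(rotate_rows L (i, a), rotate_rows L (j, b)) \<in> E \<longleftrightarrow> ((i, a), (j, b)) \<in> E"
    if ij: "(i, a) \<in> rows I L" "(j, b) \<in> rows I L" for i a j b
  proof -
    obtain c where c: "c \<in> \<pi>" "i \<in> c"
      using ij blocks(1) by auto
    show ?thesis
    proof (cases "j \<in> c")
      case True
      with c ij f(5)[OF c(1), of "(i, a)" "(j, b)"] key[OF c] show ?thesis
        by simp
    next
      case False
      with f(1)[OF c(1)] show ?thesis
        by (auto simp: key[OF c])
    qed
  qed
  ultimately show "E \<in> inv_equivs (rows I L) (rotate_rows L)"
    by (auto simp: inv_equivs_def simp del: rotate_rows_simp)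
  have "row_rel E = {(i, j). \<exists>c\<in>\<pi>. i \<in> c \<and> j \<in> c}"
  proof (intro set_eqI iffI; clarify)
    fix i j assume "(i, j) \<in> row_rel E"
    then show "\<exists>c\<in>\<pi>. i \<in> c \<and> j \<in> c"
      using f(1) by (fastforce simp: row_rel_def E_def)
  next
    fix i j c assume "c \<in> \<pi>" "i \<in> c" "j \<in> c"
    then show "(i, j) \<in> row_rel E"
      using f(6) by (fastforce simp: row_rel_def E_def)
  qed
  with partition_on_eq_quotient[OF \<pi>] show "I // row_rel E = \<pi>"
    by simp
qed

text \<open>Transitivity is where invariance enters: two links meeting row \<open>j\<close> at
  different positions are joined by rotating the first until its end hits the start of the
  second.\<close>

lemma equiv_row_rel:
  assumes E: "E \<in> inv_equivs (rows I L) (rotate_rows L)" and pos: "\<And>i. i \<in> I \<Longrightarrow> 0 < L i"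
  shows "equiv I (row_rel E)"
proof (rule equivI)
  have eq: "equiv (rows I L) E"
    using E by (simp add: inv_equivs_def)
  then have sub: "E \<subseteq> rows I L \<times> rows I L"
    by (simp add: equiv_def)
  then show "row_rel E \<subseteq> I \<times> I"
    by (auto simp: row_rel_def)
  show "refl_on I (row_rel E)"
    using eq pos unfolding refl_on_def row_rel_def equiv_def by force
  show "sym (row_rel E)"
    using eq unfolding sym_def row_rel_def equiv_def by blast
  show "trans (row_rel E)"
  proof (rule transI)
    fix i j k assume "(i, j) \<in> row_rel E" "(j, k) \<in> row_rel E"
    then obtain a b b' e where ab: "((i, a), (j, b)) \<in> E" and be: "((j, b'), (k, e)) \<in> E"
      by (auto simp: row_rel_def)
    then have lt: "i \<in> I" "j \<in> I" "a < L i" "b < L j" "b' < L j"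
      using sub by auto
    \<comment> \<open>Congruent to \<open>b' - b\<close> modulo \<open>L j\<close>, written so that
      no difference is truncated.\<close>
    define m where "m = L j - b + b'"
    have "((i, (a + m) mod L i), (j, (b + m) mod L j)) \<in> E"
      using ab lt inv_equivs_rows_shift[OF E lt(1,2), of a m b] by simp
    moreover have "(b + m) mod L j = b'"
      using lt by (simp add: m_def)
    ultimately have "((i, (a + m) mod L i), (k, e)) \<in> E"
      using be eq by (auto simp: equiv_def dest: transD)
    then show "(i, k) \<in> row_rel E"
      by (auto simp: row_rel_def)
  qed
qed

lemma inv_equiv_restrict_connected:
  assumes E: "E \<in> inv_equivs (rows I L) (rotate_rows L)" and pos: "\<And>i. i \<in> I \<Longrightarrow> 0 < L i"
    and c: "c \<in> I // row_rel E"
  shows "E \<inter> (rows c L \<times> rows c L) \<in> connected_equivs c L"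
proof -
  have eq: "equiv (rows I L) E"
    and inv: "\<And>x y. x \<in> rows I L \<Longrightarrow> y \<in> rows I L \<Longrightarrow>
      (rotate_rows L x, rotate_rows L y) \<in> E \<longleftrightarrow> (x, y) \<in> E"
    using E by (auto simp: inv_equivs_def)
  have cI: "c \<subseteq> I"
    using c equiv_row_rel[OF E pos] by (simp add: in_quotient_imp_subset)
  then have sub: "rows c L \<subseteq> rows I L"
    by (auto simp: rows_def)
  have "equiv (rows c L) (E \<inter> (rows c L \<times> rows c L))"
  proof (rule equivI)
    show "refl_on (rows c L) (E \<inter> (rows c L \<times> rows c L))"
      using eq sub by (auto simp: equiv_def refl_on_def)
    show "sym (E \<inter> (rows c L \<times> rows c L))" "trans (E \<inter> (rows c L \<times> rows c L))"
      using eq unfolding equiv_def sym_def trans_def by blast+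
  qed auto
  moreover have "rotate_rows L x \<in> rows c L" if "x \<in> rows c L" for x
    using that cI pos by (cases x) auto
  moreover have "\<exists>a b. ((i, a), (j, b)) \<in> E \<inter> (rows c L \<times> rows c L)" if ij: "i \<in> c" "j \<in> c" for i j
  proof -
    have "(i, j) \<in> row_rel E"
      using equiv_row_rel[OF E pos] c ij by (meson in_quotient_imp_in_rel insert_subset empty_subsetI)
    then obtain a b where "((i, a), (j, b)) \<in> E"
      by (auto simp: row_rel_def)
    moreover from this have "a < L i" "b < L j"
      using eq by (auto simp: equiv_def)
    ultimately show ?thesis
      using ij by auto
  qed
  moreover have "(rotate_rows L x, rotate_rows L y) \<in> E \<longleftrightarrow> (x, y) \<in> E"
    if "x \<in> rows c L" "y \<in> rows c L" for x y
    using inv sub that by blast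
  ultimately show ?thesis
    unfolding connected_equivs_def inv_equivs_def by blast
qed

lemma Union_restrict_quotient:
  assumes E: "E \<in> inv_equivs (rows I L) (rotate_rows L)" and pos: "\<And>i. i \<in> I \<Longrightarrow> 0 < L i"
  shows "(\<Union>c\<in>I // row_rel E. E \<inter> (rows c L \<times> rows c L)) = E"
proof -
  have "\<exists>c\<in>I // row_rel E. i \<in> c \<and> j \<in> c" if "((i, a), (j, b)) \<in> E" for i a j b
  proof
    have ij: "(i, j) \<in> row_rel E"
      using that by (auto simp: row_rel_def)
    moreover have "i \<in> I"
      using ij equiv_row_rel[OF E pos] by (auto simp: equiv_def)
    ultimately show "i \<in> row_rel E `` {i} \<and> j \<in> row_rel E `` {i}"
      using equiv_class_self[OF equiv_row_rel[OF E pos]] by blast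
    show "row_rel E `` {i} \<in> I // row_rel E"
      using \<open>i \<in> I\<close> by (rule quotientI)
  qed
  moreover have "E \<subseteq> rows I L \<times> rows I L"
    using E by (simp add: inv_equivs_def equiv_def)
  ultimately show ?thesis
    by fastforce
qed

text \<open>Giving an invariant relation amounts to giving a partition of the rows and,
  independently on each block, a connected piece.\<close>

lemma card_inv_equivs_rows:
  assumes I: "finite I" and pos: "\<And>i. i \<in> I \<Longrightarrow> 0 < L i"
  shows "card (inv_equivs (rows I L) (rotate_rows L))
    = (\<Sum>\<pi> | partition_on I \<pi>. \<Prod>c\<in>\<pi>. \<Sum>d | d dvd Gcd (L ` c). d ^ (card c - 1))"
proof -
  define S where "S = (SIGMA \<pi>:{\<pi>. partition_on I \<pi>}. PiE \<pi> (\<lambda>c. connected_equivs c L))"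
  define F :: "nat set set \<times> (nat set \<Rightarrow> (nat \<times> nat) rel) \<Rightarrow> (nat \<times> nat) rel"
    where "F = (\<lambda>(\<pi>, f). \<Union>c\<in>\<pi>. f c)"
  \<comment> \<open>The splitting map, inverse to the gluing \<open>F\<close>; restricting to the
    set of blocks makes the family of pieces extensional, as \<open>PiE\<close> demands.\<close>
  define G where "G E = (I // row_rel E, \<lambda>c\<in>I // row_rel E. E \<inter> (rows c L \<times> rows c L))" for E
  have "bij_betw F S (inv_equivs (rows I L) (rotate_rows L))"
  proof (rule bij_betw_byWitness[of _ G])
    show "\<forall>p\<in>S. G (F p) = p"
    proof clarify
      fix \<pi> f assume "(\<pi>, f) \<in> S"
      then have \<pi>: "partition_on I \<pi>" and f: "f \<in> PiE \<pi> (\<lambda>c. connected_equivs c L)"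
        by (auto simp: S_def)
      note U = Union_connected_equivs[OF \<pi> PiE_mem[OF f]]
      have "(\<lambda>c\<in>\<pi>. F (\<pi>, f) \<inter> (rows c L \<times> rows c L)) = (\<lambda>c\<in>\<pi>. f c)"
        by (rule restrict_ext) (use U(3) in \<open>simp add: F_def\<close>)
      also have "\<dots> = f"
        using f by (simp add: PiE_restrict)
      finally show "G (F (\<pi>, f)) = (\<pi>, f)"
        using U(2) by (simp add: G_def F_def)
    qed
    show "\<forall>E\<in>inv_equivs (rows I L) (rotate_rows L). F (G E) = E"
      using Union_restrict_quotient[OF _ pos] by (simp add: F_def G_def)
    show "F ` S \<subseteq> inv_equivs (rows I L) (rotate_rows L)"
    proof clarify
      fix \<pi> f assume "(\<pi>, f) \<in> S"
      then have \<pi>: "partition_on I \<pi>" and f: "f \<in> PiE \<pi> (\<lambda>c. connected_equivs c L)"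
        by (auto simp: S_def)
      show "F (\<pi>, f) \<in> inv_equivs (rows I L) (rotate_rows L)"
        using Union_connected_equivs(1)[OF \<pi> PiE_mem[OF f]] by (simp add: F_def)
    qed
    show "G ` inv_equivs (rows I L) (rotate_rows L) \<subseteq> S"
      using partition_on_quotient[OF equiv_row_rel[OF _ pos]] inv_equiv_restrict_connected[OF _ pos]
      by (auto simp: G_def S_def)
  qed
  then have "card (inv_equivs (rows I L) (rotate_rows L)) = card S"
    by (simp add: bij_betw_same_card)
  also have "\<dots> = (\<Sum>\<pi> | partition_on I \<pi>. \<Prod>c\<in>\<pi>. card (connected_equivs c L))"
  proof -
    have block: "finite c" "c \<noteq> {}" "c \<subseteq> I" if "partition_on I \<pi>" "c \<in> \<pi>" for \<pi> c
      using that I by (auto simp: partition_on_def intro: finite_subset)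
    have "finite {\<pi>. partition_on I \<pi>}"
      using I by (rule finitely_many_partition_on)
    moreover have "finite \<pi>" if "partition_on I \<pi>" for \<pi>
      using I that by (rule finite_elements)
    moreover have "finite (connected_equivs c L)" if "finite c" for c
      using finite_inv_equivs[OF finite_rows[OF that]] by (simp add: connected_equivs_def)
    ultimately show ?thesis
      using block unfolding S_def by (subst card_SigmaI) (auto intro!: finite_PiE sum.cong card_PiE)
  qed
  also have "\<dots> = (\<Sum>\<pi> | partition_on I \<pi>. \<Prod>c\<in>\<pi>. \<Sum>d | d dvd Gcd (L ` c). d ^ (card c - 1))"
  proof (intro sum.cong prod.cong refl card_connected_equivs)
    fix \<pi> c assume "\<pi> \<in> {\<pi>. partition_on I \<pi>}" "c \<in> \<pi>"
    then have *: "c \<noteq> {}" "c \<subseteq> I"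
      by (auto simp: partition_on_def)
    with I pos show "finite c" "c \<noteq> {}" "\<And>i. i \<in> c \<Longrightarrow> 0 < L i"
      by (blast intro: finite_subset)+
  qed
  finally show ?thesis .
qed

section \<open>Permutation actions\<close>

lemma map_prod_image_mem_iff:
  assumes "inj_on b Y" "E \<subseteq> Y \<times> Y" "x \<in> Y" "y \<in> Y"
  shows "(b x, b y) \<in> map_prod b b ` E \<longleftrightarrow> (x, y) \<in> E"
  using inj_on_image_mem_iff[OF map_prod_inj_on[OF assms(1,1)], of "(x, y)" E] assms by simp

lemma equiv_map_prod_image:
  assumes b: "bij_betw b Y X" and eq: "equiv Y E"
  shows "equiv X (map_prod b b ` E)"
proof (rule equivI)
  have X: "X = b ` Y" and inj: "inj_on b Y"
    using b by (simp_all add: bij_betw_def)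
  have sub: "E \<subseteq> Y \<times> Y"
    using eq by (simp add: equiv_def)
  then show "map_prod b b ` E \<subseteq> X \<times> X"
    by (auto simp: X)
  show "refl_on X (map_prod b b ` E)"
    using eq by (auto simp: refl_on_def X map_prod_image_mem_iff[OF inj sub] equiv_def)
  show "sym (map_prod b b ` E)"
    using eq by (auto simp: sym_def equiv_def)
  show "trans (map_prod b b ` E)"
  proof (rule transI)
    fix x y z assume "(x, y) \<in> map_prod b b ` E" "(y, z) \<in> map_prod b b ` E"
    then obtain u v v' w where uv: "(u, v) \<in> E" "(v', w) \<in> E" "x = b u" "y = b v" "y = b v'" "z = b w"
      by auto
    then have "v = v'"
      using inj sub by (auto simp: inj_on_def)
    with uv eq have "(u, w) \<in> E"
      by (auto simp: equiv_def dest: transD)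
    with uv show "(x, z) \<in> map_prod b b ` E"
      by auto
  qed
qed

text \<open>Relations are transported along \<open>b\<close> by direct image, injectively. The
  inequality, applied to \<open>b\<close> and to its inverse, gives the equality that
  follows.\<close>

lemma card_inv_equivs_le:
  assumes b: "bij_betw b Y X" and X: "finite X" and g: "\<And>y. y \<in> Y \<Longrightarrow> g y \<in> Y"
    and conj: "\<And>y. y \<in> Y \<Longrightarrow> b (g y) = f (b y)"
  shows "card (inv_equivs Y g) \<le> card (inv_equivs X f)"
proof (rule card_inj_on_le)
  have X_eq: "X = b ` Y" and inj: "inj_on b Y"
    using b by (simp_all add: bij_betw_def)
  show "finite (inv_equivs X f)"
    using X by (rule finite_inv_equivs)
  have sub: "E \<subseteq> Y \<times> Y" if "E \<in> inv_equivs Y g" for E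
    using that by (simp add: inv_equivs_def equiv_def)
  show "inj_on ((`) (map_prod b b)) (inv_equivs Y g)"
    by (rule inj_onI) (use inj_on_image_eq_iff[OF map_prod_inj_on[OF inj inj]] sub in blast)
  show "(`) (map_prod b b) ` inv_equivs Y g \<subseteq> inv_equivs X f"
  proof clarify
    fix E assume E: "E \<in> inv_equivs Y g"
    then have "equiv X (map_prod b b ` E)"
      by (simp add: inv_equivs_def equiv_map_prod_image[OF b])
    moreover have "\<forall>x\<in>X. \<forall>y\<in>X. (f x, f y) \<in> map_prod b b ` E \<longleftrightarrow> (x, y) \<in> map_prod b b ` E"
      unfolding X_eq using g E
      by (simp add: conj[symmetric] map_prod_image_mem_iff[OF inj sub[OF E]] inv_equivs_def)
    ultimately show "map_prod b b ` E \<in> inv_equivs X f"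
      by (simp add: inv_equivs_def)
  qed
qed

lemma card_inv_equivs_conj:
  assumes b: "bij_betw b Y X" and X: "finite X" and g: "\<And>y. y \<in> Y \<Longrightarrow> g y \<in> Y"
    and conj: "\<And>y. y \<in> Y \<Longrightarrow> b (g y) = f (b y)"
  shows "card (inv_equivs Y g) = card (inv_equivs X f)"
proof (rule antisym)
  show "card (inv_equivs X f) \<le> card (inv_equivs Y g)"
  proof (rule card_inv_equivs_le)
    show "bij_betw (inv_into Y b) X Y" and "finite Y"
      using b X by (simp_all add: bij_betw_inv_into bij_betw_finite)
    fix x assume "x \<in> X"
    then obtain y where y: "y \<in> Y" "x = b y"
      using b by (auto simp: bij_betw_def)
    have fx: "f x = b (g y)"
      using conj y by simp
    then show "f x \<in> X"
      using g y b by (auto simp: bij_betw_def)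
    show "inv_into Y b (f x) = g (inv_into Y b x)"
      unfolding fx using y g b by (simp add: bij_betw_inv_into_left)
  qed
qed (use assms in \<open>rule card_inv_equivs_le\<close>)

section \<open>Weighted orbit counting and Burnside's lemma\<close>

locale permutation_action =
  fixes X :: "'b set" and B :: "'c set" and act :: "('b \<Rightarrow> 'b) \<Rightarrow> 'c \<Rightarrow> 'c"
  assumes finite_X: "finite X" and finite_B: "finite B"
    and act_closed: "\<And>g x. g permutes X \<Longrightarrow> x \<in> B \<Longrightarrow> act g x \<in> B"
    and act_id: "\<And>x. x \<in> B \<Longrightarrow> act id x = x"
    and act_comp: "\<And>g h x. g permutes X \<Longrightarrow> h permutes X \<Longrightarrow> x \<in> B \<Longrightarrow> act (g \<circ> h) x = act g (act h x)"
begin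

lemma act_inv: "g permutes X \<Longrightarrow> x \<in> B \<Longrightarrow> act (inv g) (act g x) = x"
  using act_comp[of "inv g" g x] by (simp add: permutes_inv permutes_inv_o act_id)

text \<open>Right multiplication by \<open>inv h\<close> turns permutations carrying
  \<open>x\<close> to \<open>act h x\<close> into stabilizing ones; right multiplication by
  \<open>h\<close> undoes it.\<close>

lemma card_transporter:
  assumes x: "x \<in> B" and h: "h permutes X"
  shows "card {g. g permutes X \<and> act g x = act h x} = card {g. g permutes X \<and> act g (act h x) = act h x}"
proof -
  have cancel: "g \<circ> inv h \<circ> h = g" "g \<circ> h \<circ> inv h = g" for g :: "'b \<Rightarrow> 'b"
    by (simp_all add: comp_assoc permutes_inv_o[OF h])
  have hx: "act h x \<in> B" and ih: "inv h permutes X"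
    using x h by (simp_all add: act_closed permutes_inv)
  have "bij_betw (\<lambda>g. g \<circ> inv h) {g. g permutes X \<and> act g x = act h x}
      {g. g permutes X \<and> act g (act h x) = act h x}"
  proof (rule bij_betw_byWitness[of _ "\<lambda>g. g \<circ> h"])
    show "(\<lambda>g. g \<circ> inv h) ` {g. g permutes X \<and> act g x = act h x}
        \<subseteq> {g. g permutes X \<and> act g (act h x) = act h x}"
      using act_comp[OF _ ih hx] act_inv[OF h x] permutes_compose[OF ih] by auto
    show "(\<lambda>g. g \<circ> h) ` {g. g permutes X \<and> act g (act h x) = act h x}
        \<subseteq> {g. g permutes X \<and> act g x = act h x}"
      using act_comp[OF _ h x] permutes_compose[OF h] by auto
  qed ((intro ballI, rule cancel)+)
  then show ?thesis
    by (rule bij_betw_same_card)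
qed

text \<open>Orbit-stabilizer theorem with a weight \<open>F\<close> constant on orbits; \<tau> picks
  one representative per orbit. Weight 1 gives Burnside's lemma; for conjugation, weighted by the
  number of invariant relations, a sum over permutations collapses to one over cycle types.\<close>

lemma sum_card_stabilizer:
  fixes F :: "'c \<Rightarrow> nat"
  assumes T: "finite T" "\<And>t. t \<in> T \<Longrightarrow> \<tau> t \<in> B"
    and ex1: "\<And>x. x \<in> B \<Longrightarrow> \<exists>!t. t \<in> T \<and> (\<exists>g. g permutes X \<and> x = act g (\<tau> t))"
    and F: "\<And>g x. g permutes X \<Longrightarrow> x \<in> B \<Longrightarrow> F (act g x) = F x"
  shows "(\<Sum>x\<in>B. card {g. g permutes X \<and> act g x = x} * F x) = fact (card X) * (\<Sum>t\<in>T. F (\<tau> t))"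
proof -
  let ?G = "{g. g permutes X}"
  have finG: "finite ?G"
    using finite_X by (rule finite_permutations)
  \<comment> \<open>Permutations are grouped by where they send the representative; each is counted
    once, which gives the factorial.\<close>
  have orbit: "(\<Sum>x\<in>B. card {g. g permutes X \<and> act g (\<tau> t) = x} * F x) = fact (card X) * F (\<tau> t)"
    if t: "t \<in> T" for t
  proof -
    have "(\<Sum>x\<in>B. card {g. g permutes X \<and> act g (\<tau> t) = x} * F x)
        = (\<Sum>x\<in>B. \<Sum>g | g \<in> ?G \<and> act g (\<tau> t) = x. F (act g (\<tau> t)))"
      by simp
    also have "\<dots> = (\<Sum>g\<in>?G. F (act g (\<tau> t)))"
      using finG finite_B T(2)[OF t] act_closed by (intro sum.group) auto
    also have "\<dots> = (\<Sum>g\<in>?G. F (\<tau> t))"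
      using F T(2)[OF t] by (intro sum.cong) auto
    finally show ?thesis
      using card_permutations[OF refl finite_X] by simp
  qed
  \<comment> \<open>The stabilizer of \<open>x\<close> is as large as the transporter from the
    representative of its orbit; the other representatives contribute empty sets.\<close>
  have stab: "card {g. g permutes X \<and> act g x = x} = (\<Sum>t\<in>T. card {g. g permutes X \<and> act g (\<tau> t) = x})"
    if x: "x \<in> B" for x
  proof -
    obtain t h where t: "t \<in> T" "h permutes X" "x = act h (\<tau> t)"
      and uniq: "\<And>t' g. t' \<in> T \<Longrightarrow> g permutes X \<Longrightarrow> x = act g (\<tau> t') \<Longrightarrow> t' = t"
      using ex1[OF x] by metis
    have "(\<Sum>t\<in>T. card {g. g permutes X \<and> act g (\<tau> t) = x})
        = card {g. g permutes X \<and> act g (\<tau> t) = x} + (\<Sum>t\<in>T - {t}. card {g. g permutes X \<and> act g (\<tau> t) = x})"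
      using T(1) t(1) by (rule sum.remove)
    also have "(\<Sum>t\<in>T - {t}. card {g. g permutes X \<and> act g (\<tau> t) = x}) = 0"
    proof (rule sum.neutral, rule ballI)
      fix t' assume "t' \<in> T - {t}"
      then have "{g. g permutes X \<and> act g (\<tau> t') = x} = {}"
        using uniq by blast
      then show "card {g. g permutes X \<and> act g (\<tau> t') = x} = 0"
        by (simp only: card.empty)
    qed
    finally show ?thesis
      using card_transporter[OF T(2)[OF t(1)] t(2)] t(3) by simp
  qed
  have "(\<Sum>x\<in>B. card {g. g permutes X \<and> act g x = x} * F x)
      = (\<Sum>x\<in>B. \<Sum>t\<in>T. card {g. g permutes X \<and> act g (\<tau> t) = x} * F x)"
    using stab by (simp add: sum_distrib_right)
  also have "\<dots> = (\<Sum>t\<in>T. \<Sum>x\<in>B. card {g. g permutes X \<and> act g (\<tau> t) = x} * F x)"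
    by (rule sum.swap)
  also have "\<dots> = fact (card X) * (\<Sum>t\<in>T. F (\<tau> t))"
    using orbit by (simp add: sum_distrib_left)
  finally show ?thesis .
qed

definition orbit_rel :: "'c rel" where
  "orbit_rel = {(x, y). x \<in> B \<and> (\<exists>g. g permutes X \<and> y = act g x)}"

lemma equiv_orbit_rel: "equiv B orbit_rel"
proof (rule equivI)
  show "orbit_rel \<subseteq> B \<times> B"
    using act_closed by (auto simp: orbit_rel_def)
  show "refl_on B orbit_rel"
    by (auto simp: refl_on_def orbit_rel_def act_id permutes_id intro!: exI[of _ id])
  show "sym orbit_rel"
  proof (rule symI)
    fix x y assume "(x, y) \<in> orbit_rel"
    then obtain g where g: "x \<in> B" "g permutes X" "y = act g x"
      by (auto simp: orbit_rel_def)
    then have "y \<in> B" "x = act (inv g) y"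
      by (simp_all add: act_closed act_inv)
    with permutes_inv[OF g(2)] show "(y, x) \<in> orbit_rel"
      by (auto simp: orbit_rel_def)
  qed
  show "trans orbit_rel"
  proof (rule transI)
    fix x y z assume "(x, y) \<in> orbit_rel" "(y, z) \<in> orbit_rel"
    then obtain g h where gh: "x \<in> B" "g permutes X" "y = act g x" "h permutes X" "z = act h y"
      by (auto simp: orbit_rel_def)
    then have "z = act (h \<circ> g) x" "h \<circ> g permutes X"
      by (simp_all add: act_comp permutes_compose)
    with gh(1) show "(x, z) \<in> orbit_rel"
      unfolding orbit_rel_def by blast
  qed
qed

text \<open>Counted point by point; the usual sum over group elements arises in
  \<open>card_relabel_orbits\<close> by exchanging the summations.\<close>

lemma burnside:
  "(\<Sum>x\<in>B. card {g. g permutes X \<and> act g x = x}) = fact (card X) * card (B // orbit_rel)"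
proof -
  define \<tau> :: "'c set \<Rightarrow> 'c" where "\<tau> C = (SOME x. x \<in> C)" for C
  have \<tau>: "\<tau> C \<in> C" "C \<subseteq> B" if "C \<in> B // orbit_rel" for C
    using in_quotient_imp_non_empty[OF equiv_orbit_rel that]
      in_quotient_imp_subset[OF equiv_orbit_rel that] by (auto simp: \<tau>_def some_in_eq)
  have "(\<Sum>x\<in>B. card {g. g permutes X \<and> act g x = x} * 1) = fact (card X) * (\<Sum>C\<in>B // orbit_rel. 1)"
  proof (rule sum_card_stabilizer)
    show "finite (B // orbit_rel)"
      using finite_B finite_equiv_class equiv_orbit_rel by (metis equiv_type finite_quotient)
    show "\<tau> C \<in> B" if "C \<in> B // orbit_rel" for C
      using \<tau>[OF that] by blast
    show "\<exists>!C. C \<in> B // orbit_rel \<and> (\<exists>g. g permutes X \<and> x = act g (\<tau> C))" if x: "x \<in> B" for x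
    proof -
      have "(\<exists>g. g permutes X \<and> x = act g (\<tau> C)) \<longleftrightarrow> x \<in> C" if C: "C \<in> B // orbit_rel" for C
      proof -
        have "(\<exists>g. g permutes X \<and> x = act g (\<tau> C)) \<longleftrightarrow> (\<tau> C, x) \<in> orbit_rel"
          using \<tau>[OF C] by (auto simp: orbit_rel_def)
        also have "\<dots> \<longleftrightarrow> x \<in> C"
          using \<tau>(1)[OF C] C equiv_orbit_rel
          by (meson in_quotient_imp_closed in_quotient_imp_in_rel empty_subsetI insert_subset)
        finally show ?thesis .
      qed
      moreover have "\<exists>!C. C \<in> B // orbit_rel \<and> x \<in> C"
      proof (rule ex1I[of _ "orbit_rel `` {x}"])
        show "orbit_rel `` {x} \<in> B // orbit_rel \<and> x \<in> orbit_rel `` {x}"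
          using x equiv_class_self[OF equiv_orbit_rel] by (simp add: quotientI)
        then show "C = orbit_rel `` {x}" if "C \<in> B // orbit_rel \<and> x \<in> C" for C
          using that quotient_disj[OF equiv_orbit_rel] by blast
      qed
      ultimately show ?thesis
        by metis
    qed
  qed simp
  then show ?thesis
    by simp
qed

end

section \<open>Cycle types\<close>

text \<open>Rows are numbered from 1 to agree with the blocks in \<open>Par\<close>, while list
  positions start at 0.\<close>

definition cycle_rows :: "nat list \<Rightarrow> (nat \<times> nat) set" where
  "cycle_rows l = rows {1..length l} (\<lambda>i. l ! (i - 1))"

definition rotate_cycles :: "nat list \<Rightarrow> nat \<times> nat \<Rightarrow> nat \<times> nat" where
  "rotate_cycles l = rotate_rows (\<lambda>i. l ! (i - 1))"

text \<open>Conjugacy to a standard rotation, rather than a list of orbit lengths, so that two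
  permutations of equal type are conjugate by composing the witnesses.\<close>

definition has_cycle_type :: "'a set \<Rightarrow> ('a \<Rightarrow> 'a) \<Rightarrow> nat list \<Rightarrow> bool" where
  "has_cycle_type X p l \<longleftrightarrow> (\<exists>e. bij_betw e (cycle_rows l) X \<and>
     (\<forall>y\<in>cycle_rows l. e (rotate_cycles l y) = p (e y)))"

lemma card_inv_equivs_cycle_rows:
  assumes l: "l \<in> par k n"
  shows "card (inv_equivs (cycle_rows l) (rotate_cycles l)) = (\<Sum>\<pi>\<in>Par k. \<Prod>c\<in>\<pi>. block_sigma l c)"
proof -
  have "0 < l ! (i - 1)" if "i \<in> {1..length l}" for i
    using l that by (auto simp: par_def)
  then have "card (inv_equivs (cycle_rows l) (rotate_cycles l)) =
      (\<Sum>\<pi> | partition_on {1..length l} \<pi>. \<Prod>c\<in>\<pi>. \<Sum>d | d dvd Gcd ((\<lambda>i. l ! (i - 1)) ` c). d ^ (card c - 1))"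
    unfolding cycle_rows_def rotate_cycles_def by (intro card_inv_equivs_rows) auto
  then show ?thesis
    using l by (simp add: Par_def par_def block_sigma_def block_gcd_def image_def Bex_def conj_commute)
qed

lemma card_cycle_rows: "card (cycle_rows l) = sum_list l"
proof -
  have "card (cycle_rows l) = (\<Sum>i\<in>{1..length l}. l ! (i - 1))"
    unfolding cycle_rows_def rows_def by (subst card_SigmaI) auto
  also have "\<dots> = (\<Sum>i\<in>{0..<length l}. l ! i)"
    by (rule sum.reindex_bij_witness[of _ Suc "\<lambda>i. i - 1"]) auto
  finally show ?thesis
    by (simp add: sum_list_sum_nth)
qed

lemma rotate_cycles_closed: "y \<in> cycle_rows l \<Longrightarrow> rotate_cycles l y \<in> cycle_rows l"
  by (cases y) (auto simp: cycle_rows_def rotate_cycles_def intro!: mod_less_divisor)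

lemma inj_on_rotate_cycles: "inj_on (rotate_cycles l) (cycle_rows l)"
  by (auto simp: inj_on_def cycle_rows_def rotate_cycles_def mod_Suc split: if_splits)

lemma funpow_rotate_cycles:
  assumes "(i, a) \<in> cycle_rows l"
  shows "(rotate_cycles l ^^ m) (i, a) = (i, (a + m) mod l ! (i - 1))"
  using assms by (induction m) (auto simp: cycle_rows_def rotate_cycles_def mod_Suc_eq)

lemma has_cycle_type_ex:
  assumes X: "finite X" "card X = sum_list l"
  shows "\<exists>p. p permutes X \<and> has_cycle_type X p l"
proof -
  have fin: "finite (cycle_rows l)"
    by (simp add: cycle_rows_def finite_rows)
  then obtain e where e: "bij_betw e (cycle_rows l) X"
    using X card_cycle_rows finite_same_card_bij by metis
  have rot: "bij_betw (rotate_cycles l) (cycle_rows l) (cycle_rows l)"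
    using inj_on_rotate_cycles rotate_cycles_closed fin
    by (metis bij_betw_def endo_inj_surj image_subsetI)
  \<comment> \<open>The rotation transported to \<open>X\<close>, extended by the identity as
    \<open>permutes\<close> demands.\<close>
  define p where "p x = (if x \<in> X then e (rotate_cycles l (inv_into (cycle_rows l) e x)) else x)" for x
  have "bij_betw (e \<circ> rotate_cycles l \<circ> inv_into (cycle_rows l) e) X X"
    using e rot bij_betw_inv_into[OF e] by (meson bij_betw_trans)
  then have "bij_betw p X X"
    by (rule bij_betw_cong[THEN iffD1, rotated]) (simp add: p_def)
  then have "p permutes X"
    by (rule bij_imp_permutes) (simp add: p_def)
  moreover have "p (e y) = e (rotate_cycles l y)" if "y \<in> cycle_rows l" for y
    using e that by (simp add: p_def bij_betw_inv_into_left bij_betw_apply)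
  ultimately show ?thesis
    using e unfolding has_cycle_type_def by metis
qed

lemma has_cycle_type_conj:
  assumes "has_cycle_type X p l" and g: "g permutes X"
  shows "has_cycle_type X (g \<circ> p \<circ> inv g) l"
proof -
  obtain e where e: "bij_betw e (cycle_rows l) X" "\<And>y. y \<in> cycle_rows l \<Longrightarrow> e (rotate_cycles l y) = p (e y)"
    using assms unfolding has_cycle_type_def by blast
  have "bij_betw (g \<circ> e) (cycle_rows l) X"
    using e(1) permutes_imp_bij[OF g] by (rule bij_betw_trans)
  moreover have "(g \<circ> e) (rotate_cycles l y) = (g \<circ> p \<circ> inv g) ((g \<circ> e) y)" if "y \<in> cycle_rows l" for y
    using e(2)[OF that] g by (simp add: permutes_inverses)
  ultimately show ?thesis
    unfolding has_cycle_type_def by blast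
qed

lemma conj_if_has_cycle_type:
  assumes p: "p permutes X" "has_cycle_type X p l" and q: "q permutes X" "has_cycle_type X q l"
  shows "\<exists>g. g permutes X \<and> q = g \<circ> p \<circ> inv g"
proof -
  let ?Y = "cycle_rows l"
  obtain e where e: "bij_betw e ?Y X" "\<And>y. y \<in> ?Y \<Longrightarrow> e (rotate_cycles l y) = p (e y)"
    using p unfolding has_cycle_type_def by blast
  obtain e' where e': "bij_betw e' ?Y X" "\<And>y. y \<in> ?Y \<Longrightarrow> e' (rotate_cycles l y) = q (e' y)"
    using q unfolding has_cycle_type_def by blast
  define g where "g x = (if x \<in> X then e' (inv_into ?Y e x) else x)" for x
  have "bij_betw (e' \<circ> inv_into ?Y e) X X"
    using bij_betw_inv_into[OF e(1)] e'(1) by (rule bij_betw_trans)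
  then have "bij_betw g X X"
    by (rule bij_betw_cong[THEN iffD1, rotated]) (simp add: g_def)
  then have g: "g permutes X"
    by (rule bij_imp_permutes) (simp add: g_def)
  have ge: "g (e y) = e' y" if "y \<in> ?Y" for y
    using e(1) that by (simp add: g_def bij_betw_inv_into_left bij_betw_apply)
  have qg: "q (g x) = g (p x)" for x
  proof (cases "x \<in> X")
    case True
    then obtain y where "y \<in> ?Y" "x = e y"
      using e(1) by (auto simp: bij_betw_def)
    then show ?thesis
      using ge e(2) e'(2) rotate_cycles_closed by metis
  next
    case False
    then show ?thesis
      using g p(1) q(1) by (simp add: permutes_not_in)
  qed
  have "q = g \<circ> p \<circ> inv g"
  proof
    show "q x = (g \<circ> p \<circ> inv g) x" for x
      using qg[of "inv g x"] by (simp add: permutes_inverses[OF g])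
  qed
  with g show ?thesis
    by blast
qed

lemma least_power_eqI:
  assumes "\<And>m. (f ^^ m) x = x \<longleftrightarrow> d dvd m" "0 < d"
  shows "least_power f x = d"
  unfolding least_power_def by (rule Least_equality) (use assms in \<open>auto simp: dvd_imp_le\<close>)

text \<open>The period of a point is the length of its row, so the points of period \<open>d\<close>
  fill the rows of length \<open>d\<close>. The multiplicity of each part is thus recovered from the
  permutation alone.\<close>

lemma card_least_power_eq:
  assumes "has_cycle_type X p l" "0 < d"
  shows "card {x \<in> X. least_power p x = d} = d * count_list l d"
proof -
  let ?Y = "cycle_rows l"
  obtain e where e: "bij_betw e ?Y X" "\<And>y. y \<in> ?Y \<Longrightarrow> e (rotate_cycles l y) = p (e y)"
    using assms unfolding has_cycle_type_def by blast
  have lp: "least_power p (e (i, a)) = l ! (i - 1)" if y: "(i, a) \<in> ?Y" for i a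
  proof (rule least_power_eqI)
    have closed: "(rotate_cycles l ^^ m) (i, a) \<in> ?Y" for m
      by (induction m) (use y rotate_cycles_closed in auto)
    have "(p ^^ m) (e (i, a)) = e ((rotate_cycles l ^^ m) (i, a))" for m
      by (induction m) (use e(2) closed in auto)
    moreover have "e ((rotate_cycles l ^^ m) (i, a)) = e (i, a) \<longleftrightarrow> (rotate_cycles l ^^ m) (i, a) = (i, a)" for m
      using inj_on_eq_iff[OF bij_betw_imp_inj_on[OF e(1)] closed y] .
    moreover have "(a + m) mod l ! (i - 1) = a \<longleftrightarrow> l ! (i - 1) dvd m" for m
    proof -
      have "a mod l ! (i - 1) = a"
        using y by (simp add: cycle_rows_def)
      then show ?thesis
        using mod_eq_dvd_iff_nat[of a "a + m" "l ! (i - 1)"] by simp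
    qed
    ultimately show "(p ^^ m) (e (i, a)) = e (i, a) \<longleftrightarrow> l ! (i - 1) dvd m" for m
      using funpow_rotate_cycles[OF y] by simp
    show "0 < l ! (i - 1)"
      using y by (auto simp: cycle_rows_def)
  qed
  \<comment> \<open>List positions, counted from 0; the corresponding row is
    \<open>Suc i\<close>.\<close>
  let ?Z = "{i. i < length l \<and> l ! i = d}"
  have "{x \<in> X. least_power p x = d} = (\<lambda>(i, a). e (Suc i, a)) ` (?Z \<times> {..<d})"
  proof (intro set_eqI iffI)
    fix x assume x: "x \<in> {x \<in> X. least_power p x = d}"
    then obtain i a where "(i, a) \<in> ?Y" "x = e (i, a)"
      using e(1) by (auto simp: bij_betw_def)
    then show "x \<in> (\<lambda>(i, a). e (Suc i, a)) ` (?Z \<times> {..<d})"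
      using x lp by (auto simp: cycle_rows_def intro!: image_eqI[of _ _ "(i - 1, a)"])
  next
    fix x assume "x \<in> (\<lambda>(i, a). e (Suc i, a)) ` (?Z \<times> {..<d})"
    then obtain i a where "i < length l" "l ! i = d" "a < d" "x = e (Suc i, a)"
      by auto
    then show "x \<in> {x \<in> X. least_power p x = d}"
      using lp[of "Suc i" a] e(1) by (auto simp: cycle_rows_def bij_betw_def)
  qed
  moreover have "inj_on (\<lambda>(i, a). e (Suc i, a)) (?Z \<times> {..<d})"
  proof (rule inj_onI)
    fix u v
    assume u: "u \<in> ?Z \<times> {..<d}" and v: "v \<in> ?Z \<times> {..<d}"
      and eq: "(\<lambda>(i, a). e (Suc i, a)) u = (\<lambda>(i, a). e (Suc i, a)) v"
    have "(Suc (fst u), snd u) = (Suc (fst v), snd v)"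
      by (rule inj_onD[OF bij_betw_imp_inj_on[OF e(1)]])
        (use u v eq in \<open>auto simp: cycle_rows_def case_prod_beta\<close>)
    then show "u = v"
      by (simp add: prod_eq_iff)
  qed
  moreover have "card ?Z = count_list l d"
    unfolding count_list_eq_length_filter length_filter_conv_card by (rule arg_cong[of _ _ card]) auto
  ultimately show ?thesis
    by (simp add: card_image)
qed

text \<open>The multiplicities agree, and a nonincreasing list is determined by its multiset.
  Positivity of the parts settles the value 0, which no period can detect.\<close>

lemma has_cycle_type_unique:
  assumes l: "has_cycle_type X p l" "l \<in> par k n" and l': "has_cycle_type X p l'" "l' \<in> par k' n'"
  shows "l = l'"
proof -
  have "count_list l d = count_list l' d" for d
  proof (cases "d = 0")
    case True
    then show ?thesis
      using l(2) l'(2) count_notin[of 0] unfolding par_def by (metis (mono_tags, lifting) less_irrefl mem_Collect_eq)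
  next
    case False
    then show ?thesis
      using card_least_power_eq[OF l(1), of d] card_least_power_eq[OF l'(1), of d] by simp
  qed
  then have "mset (rev l) = mset (rev l')"
    by (intro multiset_eqI) (simp add: count_mset)
  moreover have "sorted (rev l)" "sorted (rev l')"
    using l(2) l'(2) by (auto simp: par_def sorted_wrt_rev)
  ultimately have "rev l = rev l'"
    by (metis properties_for_sort)
  then show ?thesis
    by simp
qed

text \<open>Each orbit is unrolled from a chosen representative into one row, and the rows are
  ordered by decreasing length.\<close>

lemma ex_has_cycle_type:
  assumes X: "finite X" and p: "p permutes X"
  shows "\<exists>k l. l \<in> par k (card X) \<and> has_cycle_type X p l"
proof -
  have perm: "permutation p"
    using X p by (auto simp: permutation_permutes)
  \<comment> \<open>The choice depends only on the orbit as a set, so points of one orbit get the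
    same representative.\<close>
  define rep where "rep x = (SOME y. y \<in> orbit p x)" for x
  have rep: "rep x \<in> orbit p x" for x
    unfolding rep_def by (rule someI) (rule permutation_self_in_orbit[OF perm])
  have orbit_eq: "orbit p y = orbit p x" if "y \<in> orbit p x" for x y
    using orbit_cyclic_eq3[OF cyclic_on_orbit'[OF perm] that] .
  have rep_eq: "rep y = rep x" if "y \<in> orbit p x" for x y
    using orbit_eq[OF that] by (simp add: rep_def)
  have repX: "rep x \<in> X" if "x \<in> X" for x
    using rep that permutes_orbit_subset[OF p] by blast
  obtain ys where ys: "set ys = rep ` X" "distinct ys"
    using finite_distinct_list[OF finite_imageI[OF X, of rep]] by blast
  define xs where "xs = rev (sort_key (least_power p) ys)"
  define l where "l = map (least_power p) xs"
  have xs: "set xs = rep ` X" "distinct xs"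
    using ys by (auto simp: xs_def)
  have reps: "rep r = r \<and> r \<in> X" if "r \<in> set xs" for r
  proof -
    obtain x where "x \<in> X" "r = rep x"
      using \<open>r \<in> set xs\<close> xs(1) by auto
    then show ?thesis
      using rep_eq[OF rep, of x] repX by simp
  qed
  have pos: "0 < least_power p x" for x
    using least_power_of_permutation(2)[OF perm] .
  define e where "e = (\<lambda>(i, a). (p ^^ a) (xs ! (i - 1)))"
  have mem: "(i, a) \<in> cycle_rows l \<longleftrightarrow> 1 \<le> i \<and> i \<le> length xs \<and> a < least_power p (xs ! (i - 1))" for i a
    by (auto simp: cycle_rows_def l_def)
  have in_orbit: "(p ^^ a) x \<in> orbit p x" for a x
    using perm by (auto simp: orbit_altdef_permutation)
  have "inj_on e (cycle_rows l)"
  proof (rule inj_onI, clarify)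
    fix i a j b
    assume ia: "(i, a) \<in> cycle_rows l" and jb: "(j, b) \<in> cycle_rows l" and eq: "e (i, a) = e (j, b)"
    let ?x = "xs ! (i - 1)" and ?y = "xs ! (j - 1)"
    have "?x \<in> set xs" "?y \<in> set xs"
      using ia jb by (auto simp: mem)
    moreover have "rep ?x = rep ?y"
      using eq rep_eq[OF in_orbit, of a ?x] rep_eq[OF in_orbit, of b ?y] by (simp add: e_def)
    ultimately have xy: "?x = ?y"
      using reps by metis
    then have ij: "i = j"
      using ia jb xs(2) by (auto simp: mem nth_eq_iff_index_eq)
    have "inj_on (\<lambda>a. (p ^^ a) ?x) {0..<least_power p ?x}"
      using cycle_of_permutation[OF perm, of ?x] by (simp add: distinct_map)
    then have "a = b"
      using eq ia jb xy ij by (auto simp: inj_on_def mem e_def)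
    with ij show "i = j \<and> a = b"
      by simp
  qed
  moreover have "e ` cycle_rows l = X"
  proof (intro set_eqI iffI)
    fix x assume "x \<in> e ` cycle_rows l"
    then obtain i a where "(i, a) \<in> cycle_rows l" "x = (p ^^ a) (xs ! (i - 1))"
      by (auto simp: e_def)
    moreover from this have "xs ! (i - 1) \<in> X"
      using reps[of "xs ! (i - 1)"] by (auto simp: mem)
    ultimately show "x \<in> X"
      using permutes_in_image[OF permutes_funpow[OF p]] by simp
  next
    fix x assume x: "x \<in> X"
    then obtain i where i: "i < length xs" "xs ! i = rep x"
      using xs(1) by (metis image_eqI in_set_conv_nth)
    have "x \<in> orbit p (rep x)"
      using orbit_eq[OF rep, of x] permutation_self_in_orbit[OF perm, of x] by simp
    then have "x \<in> set (support p (rep x))"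
      unfolding support_set[OF perm] using perm by (auto simp: orbit_altdef_permutation)
    then obtain a where "a < least_power p (rep x)" "x = (p ^^ a) (rep x)"
      by auto
    with i show "x \<in> e ` cycle_rows l"
      by (intro image_eqI[of _ _ "(Suc i, a)"]) (auto simp: e_def mem)
  qed
  ultimately have bij: "bij_betw e (cycle_rows l) X"
    by (simp add: bij_betw_def)
  have "e (rotate_cycles l (i, a)) = p (e (i, a))" if "(i, a) \<in> cycle_rows l" for i a
  proof -
    let ?x = "xs ! (i - 1)"
    have "l ! (i - 1) = least_power p ?x"
      using that unfolding mem by (auto simp: l_def)
    moreover have "(p ^^ (Suc a mod least_power p ?x)) ?x = (p ^^ Suc a) ?x"
      using least_power_of_permutation(1)[OF perm] by (rule funpow_mod_eq)
    ultimately show ?thesis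
      by (simp add: e_def rotate_cycles_def)
  qed
  with bij have "has_cycle_type X p l"
    unfolding has_cycle_type_def by fast
  moreover have "l \<in> par (length l) (card X)"
  proof -
    have "sorted_wrt (\<ge>) l"
      unfolding l_def xs_def rev_map[symmetric] sorted_wrt_rev by simp
    moreover have "sum_list l = card X"
      using bij_betw_same_card[OF bij] card_cycle_rows by metis
    ultimately show ?thesis
      using pos by (auto simp: par_def l_def)
  qed
  ultimately show ?thesis
    by blast
qed

section \<open>Relabelling permutations with an equivalence relation\<close>

definition perm_equivs :: "'a set \<Rightarrow> (('a \<Rightarrow> 'a) \<times> 'a rel) set" where
  "perm_equivs X = {p. p permutes X} \<times> {E. equiv X E}"

definition relabel :: "('a \<Rightarrow> 'a) \<Rightarrow> ('a \<Rightarrow> 'a) \<times> 'a rel \<Rightarrow> ('a \<Rightarrow> 'a) \<times> 'a rel" where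
  "relabel g = (\<lambda>(p, E). (g \<circ> p \<circ> inv g, map_prod g g ` E))"

lemma conj_permutes: "g permutes X \<Longrightarrow> p permutes X \<Longrightarrow> g \<circ> p \<circ> inv g permutes X"
  by (simp add: permutes_compose permutes_inv)

lemma conj_comp:
  assumes "g permutes X" "h permutes X"
  shows "(g \<circ> h) \<circ> p \<circ> inv (g \<circ> h) = g \<circ> (h \<circ> p \<circ> inv h) \<circ> inv g"
  using assms by (simp add: o_inv_distrib permutes_bij comp_assoc)

lemma conj_eq_iff: "g permutes X \<Longrightarrow> g \<circ> p \<circ> inv g = q \<longleftrightarrow> g \<circ> p = q \<circ> g"
  by (metis comp_assoc comp_id permutes_inv_o)

lemma permutation_action_conj:
  assumes "finite X"
  shows "permutation_action X {p. p permutes X} (\<lambda>g p. g \<circ> p \<circ> inv g)"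
  using assms by unfold_locales (auto simp: finite_permutations conj_permutes intro: conj_comp)

lemma finite_equivs: "finite X \<Longrightarrow> finite {E. equiv X E}"
  by (rule finite_subset[of _ "Pow (X \<times> X)"]) (auto simp: equiv_def)

lemma permutation_action_relabel:
  assumes "finite X"
  shows "permutation_action X (perm_equivs X) relabel"
proof
  show "finite (perm_equivs X)"
    using assms by (simp add: perm_equivs_def finite_permutations finite_equivs)
  show "relabel g x \<in> perm_equivs X" if "g permutes X" "x \<in> perm_equivs X" for g x
    using that by (auto simp: relabel_def perm_equivs_def conj_permutes
        intro: equiv_map_prod_image[OF permutes_imp_bij])
  show "relabel (g \<circ> h) x = relabel g (relabel h x)" if "g permutes X" "h permutes X" for g h x
    using conj_comp[OF that]
    by (auto simp: relabel_def image_comp map_prod.comp split: prod.splits)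
qed (use assms in \<open>auto simp: relabel_def map_prod.id\<close>)

lemma map_prod_image_eq_iff:
  assumes g: "g permutes X" and E: "equiv X E"
  shows "map_prod g g ` E = E \<longleftrightarrow> E \<in> inv_equivs X g"
proof -
  have sub: "E \<subseteq> X \<times> X"
    using E by (simp add: equiv_def)
  note mem = map_prod_image_mem_iff[OF permutes_inj_on[OF g] sub]
  have "map_prod g g ` E = E" if inv: "\<forall>x\<in>X. \<forall>y\<in>X. (g x, g y) \<in> E \<longleftrightarrow> (x, y) \<in> E"
  proof (intro set_eqI iffI; clarify)
    fix u v assume uv: "(u, v) \<in> E"
    then have X: "inv g u \<in> X" "inv g v \<in> X"
      using sub permutes_in_image[OF permutes_inv[OF g]] by auto
    moreover have "g (inv g u) = u" "g (inv g v) = v"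
      using g by (simp_all add: permutes_inverses)
    ultimately show "(u, v) \<in> map_prod g g ` E"
      using inv[rule_format, OF X] uv mem[OF X] by simp
  qed (use inv sub in auto)
  moreover have "(g x, g y) \<in> E \<longleftrightarrow> (x, y) \<in> E" if "map_prod g g ` E = E" "x \<in> X" "y \<in> X" for x y
    using mem[OF that(2,3)] that(1) by simp
  ultimately show ?thesis
    using E by (auto simp: inv_equivs_def)
qed

text \<open>Fixing \<open>p\<close> means commuting with it, a symmetric condition; it is written as
  \<open>p\<close> stabilizing \<open>g\<close> under conjugation, the form in which
  \<open>sum_card_stabilizer\<close> applies.\<close>

lemma fixed_perm_equivs:
  assumes g: "g permutes X"
  shows "{x \<in> perm_equivs X. relabel g x = x} = {p. p permutes X \<and> p \<circ> g \<circ> inv p = g} \<times> inv_equivs X g"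
proof -
  have "g \<circ> p \<circ> inv g = p \<longleftrightarrow> p \<circ> g \<circ> inv p = g" if "p permutes X" for p
    using conj_eq_iff[OF g] conj_eq_iff[OF that] by metis
  moreover have "E \<in> inv_equivs X g \<longleftrightarrow> equiv X E \<and> map_prod g g ` E = E" for E
    using map_prod_image_eq_iff[OF g, of E] by (auto simp: inv_equivs_def)
  ultimately show ?thesis
    by (auto simp: perm_equivs_def relabel_def)
qed

lemma card_inv_equivs_cycle_type:
  assumes X: "finite X" and p: "has_cycle_type X p l"
  shows "card (inv_equivs X p) = card (inv_equivs (cycle_rows l) (rotate_cycles l))"
proof -
  obtain e where "bij_betw e (cycle_rows l) X" "\<And>y. y \<in> cycle_rows l \<Longrightarrow> e (rotate_cycles l y) = p (e y)"
    using p unfolding has_cycle_type_def by blast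
  then show ?thesis
    by (intro card_inv_equivs_conj[symmetric, OF _ X rotate_cycles_closed])
qed

text \<open>Ensures that the range of \<open>k\<close> in the sum misses no cycle type; a positive
  total rules out the empty list.\<close>

lemma par_bounds:
  assumes "l \<in> par k n" "n \<ge> 1"
  shows "k \<in> {1..n}"
proof -
  have "length l \<le> sum_list l"
  proof -
    have "sum_list (map (\<lambda>_. 1) l) \<le> sum_list (map (\<lambda>x. x) l)"
      using assms(1) by (intro sum_list_mono) (auto simp: par_def Suc_le_eq)
    then show ?thesis
      by (simp add: sum_list_triv)
  qed
  with assms show ?thesis
    by (cases l) (auto simp: par_def)
qed

lemma card_relabel_orbits:
  assumes X: "finite X" "card X = n" and n: "n \<ge> 1"
  shows "card (perm_equivs X // permutation_action.orbit_rel X (perm_equivs X) relabel)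
    = (\<Sum>k = 1..n. \<Sum>l\<in>par k n. \<Sum>\<pi>\<in>Par k. \<Prod>c\<in>\<pi>. block_sigma l c)"
proof -
  interpret pairs: permutation_action X "perm_equivs X" relabel
    using X(1) by (rule permutation_action_relabel)
  interpret conj: permutation_action X "{p. p permutes X}" "\<lambda>g p. g \<circ> p \<circ> inv g"
    using X(1) by (rule permutation_action_conj)
  define T where "T = (\<Union>k\<in>{1..n}. par k n)"
  have "\<exists>p. p permutes X \<and> has_cycle_type X p l" if "l \<in> T" for l
    using that X by (intro has_cycle_type_ex) (auto simp: T_def par_def)
  then obtain \<tau> where \<tau>: "\<And>l. l \<in> T \<Longrightarrow> \<tau> l permutes X" "\<And>l. l \<in> T \<Longrightarrow> has_cycle_type X (\<tau> l) l"
    by metis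
  have "fact n * card (perm_equivs X // pairs.orbit_rel)
      = (\<Sum>x\<in>perm_equivs X. card {g. g permutes X \<and> relabel g x = x})"
    using pairs.burnside X by simp
  also have "\<dots> = (\<Sum>x\<in>perm_equivs X. \<Sum>g | g permutes X. if relabel g x = x then 1 else 0)"
    using conj.finite_B by (simp add: sum.If_cases Int_def)
  \<comment> \<open>The fixed pairs are recounted permutation by permutation.\<close>
  also have "\<dots> = (\<Sum>g | g permutes X. \<Sum>x\<in>perm_equivs X. if relabel g x = x then 1 else 0)"
    by (rule sum.swap)
  also have "\<dots> = (\<Sum>g | g permutes X. card {x \<in> perm_equivs X. relabel g x = x})"
    using pairs.finite_B by (simp add: sum.If_cases Int_def)
  also have "\<dots> = (\<Sum>g | g permutes X. card {p. p permutes X \<and> p \<circ> g \<circ> inv p = g} * card (inv_equivs X g))"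
    by (intro sum.cong) (simp_all add: fixed_perm_equivs card_cartesian_product)
  \<comment> \<open>Orbit counting a second time, now for conjugation: the permutations commuting
    with \<open>g\<close> form its stabilizer, the number of invariant relations is the weight, and
    cycle types index the orbits.\<close>
  also have "\<dots> = fact (card X) * (\<Sum>l\<in>T. card (inv_equivs X (\<tau> l)))"
  proof (rule conj.sum_card_stabilizer)
    show "finite T"
      by (simp add: T_def finite_par)
    show "\<tau> l \<in> {p. p permutes X}" if "l \<in> T" for l
      using \<tau>(1)[OF that] by simp
    show "\<exists>!l. l \<in> T \<and> (\<exists>g. g permutes X \<and> p = g \<circ> \<tau> l \<circ> inv g)" if "p \<in> {p. p permutes X}" for p
    proof -
      have p: "p permutes X"
        using that by simp
      obtain k l where l: "l \<in> par k n" "has_cycle_type X p l"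
        using ex_has_cycle_type[OF X(1) p] X(2) by blast
      then have "l \<in> T"
        using par_bounds[OF _ n] by (auto simp: T_def)
      show ?thesis
      proof (rule ex1I)
        show "l \<in> T \<and> (\<exists>g. g permutes X \<and> p = g \<circ> \<tau> l \<circ> inv g)"
          using \<open>l \<in> T\<close> conj_if_has_cycle_type[OF \<tau>[OF \<open>l \<in> T\<close>] p l(2)] by blast
        fix l' assume l': "l' \<in> T \<and> (\<exists>g. g permutes X \<and> p = g \<circ> \<tau> l' \<circ> inv g)"
        then have "has_cycle_type X p l'"
          using has_cycle_type_conj \<tau>(2) by blast
        moreover obtain k' where "l' \<in> par k' n"
          using l' by (auto simp: T_def)
        ultimately show "l' = l"
          using has_cycle_type_unique l by blast
      qed
    qed
    show "card (inv_equivs X (g \<circ> p \<circ> inv g)) = card (inv_equivs X p)"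
      if g: "g permutes X" and "p \<in> {p. p permutes X}" for g p
    proof (rule card_inv_equivs_conj[symmetric])
      show "bij_betw g X X"
        using g by (rule permutes_imp_bij)
      show "p x \<in> X" if "x \<in> X" for x
        using \<open>p \<in> {p. p permutes X}\<close> that by (simp add: permutes_in_image)
      show "g (p x) = (g \<circ> p \<circ> inv g) (g x)" for x
        using g by (simp add: permutes_inverses)
    qed fact
  qed
  finally have "card (perm_equivs X // pairs.orbit_rel) = (\<Sum>l\<in>T. card (inv_equivs X (\<tau> l)))"
    using X(2) by simp
  also have "\<dots> = (\<Sum>k = 1..n. \<Sum>l\<in>par k n. card (inv_equivs X (\<tau> l)))"
    unfolding T_def by (rule sum.UNION_disjoint) (simp, simp add: finite_par, auto simp: par_def)
  also have "\<dots> = (\<Sum>k = 1..n. \<Sum>l\<in>par k n. \<Sum>\<pi>\<in>Par k. \<Prod>c\<in>\<pi>. block_sigma l c)"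
  proof (intro sum.cong refl)
    fix k l assume k: "k \<in> {1..n}" and l: "l \<in> par k n"
    then have "l \<in> T"
      by (auto simp: T_def)
    then show "card (inv_equivs X (\<tau> l)) = (\<Sum>\<pi>\<in>Par k. \<Prod>c\<in>\<pi>. block_sigma l c)"
      using card_inv_equivs_cycle_type[OF X(1) \<tau>(2)] card_inv_equivs_cycle_rows[OF l] by simp
  qed
  finally show ?thesis .
qed

section \<open>Micro-macro systems as permutations with an equivalence relation\<close>

text \<open>As the projections are onto, a compatible bijection of macrostates exists exactly when
  \<beta> preserves and reflects lying over the same macrostate. This removes the names of
  macrostates from the problem.\<close>

lemma micro_macro_iso_kernel_iff:
  assumes S: "micro_macro_system S" and T: "micro_macro_system T"
  shows "micro_macro_iso S T \<longleftrightarrow>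
     (\<exists>\<beta>. bij_betw \<beta> (micro S) (micro T) \<and> (\<forall>x\<in>micro S. dyn T (\<beta> x) = \<beta> (dyn S x)) \<and>
       (\<forall>x\<in>micro S. \<forall>y\<in>micro S. proj S x = proj S y \<longleftrightarrow> proj T (\<beta> x) = proj T (\<beta> y)))"
    (is "_ \<longleftrightarrow> ?R")
proof
  assume "micro_macro_iso S T"
  then obtain \<beta> \<beta>' where \<beta>: "bij_betw \<beta> (micro S) (micro T)" "\<forall>x\<in>micro S. dyn T (\<beta> x) = \<beta> (dyn S x)"
    and \<beta>': "bij_betw \<beta>' (macro S) (macro T)" "\<And>x. x \<in> micro S \<Longrightarrow> \<beta>' (proj S x) = proj T (\<beta> x)"
    using micro_macro_iso_alt[OF S T] by blast
  have "proj S x = proj S y \<longleftrightarrow> proj T (\<beta> x) = proj T (\<beta> y)" if "x \<in> micro S" "y \<in> micro S" for x y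
  proof -
    have "proj S x \<in> macro S" "proj S y \<in> macro S"
      using S that by (auto simp: micro_macro_system_def)
    then show ?thesis
      using inj_on_eq_iff[OF bij_betw_imp_inj_on[OF \<beta>'(1)]] \<beta>'(2)[OF that(1)] \<beta>'(2)[OF that(2)] by metis
  qed
  with \<beta> show ?R
    by blast
next
  assume ?R
  then obtain \<beta> where \<beta>: "bij_betw \<beta> (micro S) (micro T)" "\<forall>x\<in>micro S. dyn T (\<beta> x) = \<beta> (dyn S x)"
    and ker: "\<And>x y. x \<in> micro S \<Longrightarrow> y \<in> micro S \<Longrightarrow> proj S x = proj S y \<longleftrightarrow> proj T (\<beta> x) = proj T (\<beta> y)"
    by blast
  have mS: "macro S = proj S ` micro S" and mT: "macro T = proj T ` \<beta> ` micro S"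
    using S T \<beta>(1) by (auto simp: micro_macro_system_def bij_betw_def)
  \<comment> \<open>A macrostate is lifted to some microstate over it; preservation of kernels makes
    the result independent of the lift.\<close>
  define \<beta>' where "\<beta>' a = proj T (\<beta> (inv_into (micro S) (proj S) a))" for a
  have \<beta>': "\<beta>' (proj S x) = proj T (\<beta> x)" if "x \<in> micro S" for x
  proof -
    let ?y = "inv_into (micro S) (proj S) (proj S x)"
    have "?y \<in> micro S" "proj S ?y = proj S x"
      using that by (simp_all add: inv_into_into f_inv_into_f)
    with ker that show ?thesis
      unfolding \<beta>'_def by blast
  qed
  have "bij_betw \<beta>' (macro S) (macro T)"
    unfolding bij_betw_def
  proof
    show "inj_on \<beta>' (macro S)"
      unfolding mS by (rule inj_onI) (use \<beta>' ker in auto)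
    show "\<beta>' ` macro S = macro T"
      unfolding mS mT image_image using \<beta>' by (rule image_cong[OF refl])
  qed
  with \<beta> \<beta>' show "micro_macro_iso S T"
    unfolding micro_macro_iso_alt[OF S T] by blast
qed

text \<open>Preserving and reflecting the relations and meeting every class, \<open>f\<close>
  induces a bijection of quotients even when it is neither injective nor onto. Systems on one fixed
  \<open>X\<close> can thus stand for all systems.\<close>

lemma card_quotient_eqI:
  assumes r: "equiv A r" and s: "equiv B s" and f: "\<And>x. x \<in> B \<Longrightarrow> f x \<in> A"
    and rel: "\<And>x y. x \<in> B \<Longrightarrow> y \<in> B \<Longrightarrow> (f x, f y) \<in> r \<longleftrightarrow> (x, y) \<in> s"
    and surj: "\<And>a. a \<in> A \<Longrightarrow> \<exists>x\<in>B. (f x, a) \<in> r"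
  shows "card (A // r) = card (B // s)"
proof -
  have img: "r `` (f ` (s `` {x})) = r `` {f x}" if x: "x \<in> B" for x
  proof -
    have cls: "r `` {f y} = r `` {f x}" if y: "y \<in> s `` {x}" for y
    proof -
      have "y \<in> B"
        using s y by (auto simp: equiv_def)
      then have "(f x, f y) \<in> r"
        using rel[OF x] y by simp
      then show ?thesis
        by (rule equiv_class_eq[OF r, symmetric])
    qed
    have "r `` (f ` (s `` {x})) = (\<Union>y\<in>s `` {x}. r `` {f y})"
      by blast
    also have "\<dots> = (\<Union>y\<in>s `` {x}. r `` {f x})"
      by (rule SUP_cong[OF refl cls])
    also have "\<dots> = r `` {f x}"
      using equiv_class_self[OF s x] by blast
    finally show ?thesis .
  qed
  have "bij_betw (\<lambda>C. r `` (f ` C)) (B // s) (A // r)"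
    unfolding bij_betw_def
  proof
    show "inj_on (\<lambda>C. r `` (f ` C)) (B // s)"
    proof (rule inj_onI)
      fix C D assume "C \<in> B // s" "D \<in> B // s" and eq: "r `` (f ` C) = r `` (f ` D)"
      then obtain x y where x: "x \<in> B" "C = s `` {x}" and y: "y \<in> B" "D = s `` {y}"
        by (auto elim!: quotientE)
      then have "r `` {f x} = r `` {f y}"
        using eq img by simp
      then have "(f x, f y) \<in> r"
        using r f[OF y(1)] by (rule eq_equiv_class)
      then have "(x, y) \<in> s"
        using rel x y by simp
      with x y show "C = D"
        using equiv_class_eq[OF s] by simp
    qed
    show "(\<lambda>C. r `` (f ` C)) ` (B // s) = A // r"
    proof (intro set_eqI iffI)
      fix D assume "D \<in> (\<lambda>C. r `` (f ` C)) ` (B // s)"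
      then obtain x where "x \<in> B" "D = r `` {f x}"
        using img by (auto elim!: quotientE)
      then show "D \<in> A // r"
        using f by (simp add: quotientI)
    next
      fix D assume "D \<in> A // r"
      then obtain a where a: "a \<in> A" "D = r `` {a}"
        by (rule quotientE)
      then obtain x where x: "x \<in> B" "(f x, a) \<in> r"
        using surj by blast
      then have "D = r `` (f ` (s `` {x}))"
        using a equiv_class_eq[OF r x(2)] img[OF x(1)] by simp
      then show "D \<in> (\<lambda>C. r `` (f ` C)) ` (B // s)"
        using x(1) by (auto intro: quotientI)
    qed
  qed
  then show ?thesis
    by (simp add: bij_betw_same_card)
qed

text \<open>\<open>e\<close> encodes equivalence classes as elements of the given macrostate type,
  which may be unrelated to sets of microstates.\<close>

definition system_of :: "('x set \<Rightarrow> 'a) \<Rightarrow> 'x set \<Rightarrow> ('x \<Rightarrow> 'x) \<times> 'x rel \<Rightarrow> ('x, 'a) micro_macro" where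
  "system_of e X = (\<lambda>(p, E). \<lparr>micro = X, macro = (\<lambda>x. e (E `` {x})) ` X, proj = (\<lambda>x. e (E `` {x})), dyn = p\<rparr>)"

lemma system_of_system:
  assumes "finite X" "p permutes X"
  shows "micro_macro_system (system_of e X (p, E))"
  using assms by (simp add: system_of_def micro_macro_system_def permutes_imp_bij)

lemma class_label_eq_iff:
  assumes e: "inj_on e (Pow X)" and E: "equiv X E" and "x \<in> X" "y \<in> X"
  shows "e (E `` {x}) = e (E `` {y}) \<longleftrightarrow> (x, y) \<in> E"
proof -
  have "E `` {z} \<in> Pow X" for z
    using E by (auto simp: equiv_def)
  then have "e (E `` {x}) = e (E `` {y}) \<longleftrightarrow> E `` {x} = E `` {y}"
    using e by (simp add: inj_on_eq_iff)
  then show ?thesis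
    using eq_equiv_class_iff[OF E] assms by simp
qed

lemma system_of_iso_iff:
  assumes X: "finite X" and e: "inj_on e (Pow X)"
    and p: "p permutes X" "equiv X E" and q: "q permutes X" "equiv X F"
  shows "micro_macro_iso (system_of e X (p, E)) (system_of e X (q, F)) \<longleftrightarrow>
    (\<exists>g. g permutes X \<and> (q, F) = relabel g (p, E))" (is "?iso \<longleftrightarrow> ?R")
proof -
  have iso: "?iso \<longleftrightarrow> (\<exists>\<beta>. bij_betw \<beta> X X \<and> (\<forall>x\<in>X. q (\<beta> x) = \<beta> (p x)) \<and>
      (\<forall>x\<in>X. \<forall>y\<in>X. e (E `` {x}) = e (E `` {y}) \<longleftrightarrow> e (F `` {\<beta> x}) = e (F `` {\<beta> y})))"
    using micro_macro_iso_kernel_iff[OF system_of_system[OF X p(1)] system_of_system[OF X q(1)]]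
    by (simp add: system_of_def)
  have sub: "E \<subseteq> X \<times> X" "F \<subseteq> X \<times> X"
    using p q by (simp_all add: equiv_def)
  show ?thesis
  proof
    assume ?iso
    then obtain \<beta> where \<beta>: "bij_betw \<beta> X X" "\<And>x. x \<in> X \<Longrightarrow> q (\<beta> x) = \<beta> (p x)"
      and ker: "\<And>x y. x \<in> X \<Longrightarrow> y \<in> X \<Longrightarrow> e (E `` {x}) = e (E `` {y}) \<longleftrightarrow> e (F `` {\<beta> x}) = e (F `` {\<beta> y})"
      using iso by blast
    \<comment> \<open>\<beta> is arbitrary outside \<open>X\<close>; extension by the identity makes
      it a permutation in the sense of \<open>permutes\<close>.\<close>
    define g where "g x = (if x \<in> X then \<beta> x else x)" for x
    have "bij_betw g X X"
      using \<beta>(1) by (rule bij_betw_cong[THEN iffD1, rotated]) (simp add: g_def)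
    then have g: "g permutes X"
      by (rule bij_imp_permutes) (simp add: g_def)
    have gX: "g x \<in> X" if "x \<in> X" for x
      using g that by (simp add: permutes_in_image)
    have "g (p x) = q (g x)" for x
      using \<beta>(2) p(1) q(1) by (cases "x \<in> X") (simp_all add: g_def permutes_in_image permutes_not_in)
    then have "g \<circ> p \<circ> inv g = q"
      unfolding conj_eq_iff[OF g] by auto
    moreover have EF: "(g x, g y) \<in> F \<longleftrightarrow> (x, y) \<in> E" if "x \<in> X" "y \<in> X" for x y
      using ker[OF that] class_label_eq_iff[OF e p(2) that] class_label_eq_iff[OF e q(2) gX gX, OF that] that
      by (simp add: g_def)
    have "map_prod g g ` E = F"
    proof (intro set_eqI iffI; clarify)
      fix u v assume uv: "(u, v) \<in> F"
      have inv: "inv g u \<in> X" "inv g v \<in> X" "g (inv g u) = u" "g (inv g v) = v"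
        using uv sub g permutes_in_image[OF permutes_inv[OF g]] by (auto simp: permutes_inverses)
      then have "(inv g u, inv g v) \<in> E"
        using EF[of "inv g u" "inv g v"] uv by simp
      then show "(u, v) \<in> map_prod g g ` E"
        using inv by (auto intro!: image_eqI[of _ _ "(inv g u, inv g v)"])
    qed (use EF sub in auto)
    ultimately show ?R
      using g by (auto simp: relabel_def)
  next
    assume ?R
    then obtain g where g: "g permutes X" and q_eq: "g \<circ> p \<circ> inv g = q" and F_eq: "F = map_prod g g ` E"
      by (auto simp: relabel_def)
    have gX: "g x \<in> X" if "x \<in> X" for x
      using g that by (simp add: permutes_in_image)
    have "g \<circ> p = q \<circ> g"
      using q_eq conj_eq_iff[OF g] by blast
    then have "q (g x) = g (p x)" for x
      by (simp add: fun_eq_iff)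
    moreover have "e (E `` {x}) = e (E `` {y}) \<longleftrightarrow> e (F `` {g x}) = e (F `` {g y})" if "x \<in> X" "y \<in> X" for x y
      using class_label_eq_iff[OF e p(2) that] class_label_eq_iff[OF e q(2) gX gX, OF that]
        map_prod_image_mem_iff[OF permutes_inj_on[OF g] sub(1) that] by (simp add: F_eq)
    ultimately show ?iso
      unfolding iso using permutes_imp_bij[OF g] by blast
  qed
qed

text \<open>Any bijection from the microstates of \<open>S\<close> to \<open>X\<close> transports
  the dynamics to \<open>p\<close> and the kernel of the projection to \<open>E\<close>.\<close>

lemma ex_system_of_iso:
  assumes S: "micro_macro_system S" and X: "finite X" "card X = card (micro S)" and e: "inj_on e (Pow X)"
  shows "\<exists>p E. p permutes X \<and> equiv X E \<and> micro_macro_iso (system_of e X (p, E)) S"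
proof -
  have fin: "finite (micro S)" and dyn: "bij_betw (dyn S) (micro S) (micro S)"
    using S by (simp_all add: micro_macro_system_def)
  obtain b where b: "bij_betw b (micro S) X"
    using finite_same_card_bij[OF fin X(1)] X(2) by auto
  define p where "p y = (if y \<in> X then b (dyn S (inv_into (micro S) b y)) else y)" for y
  define E where "E = map_prod b b ` {(x, y). x \<in> micro S \<and> y \<in> micro S \<and> proj S x = proj S y}"
  have "bij_betw (b \<circ> dyn S \<circ> inv_into (micro S) b) X X"
    using b dyn bij_betw_inv_into[OF b] by (meson bij_betw_trans)
  then have "bij_betw p X X"
    by (rule bij_betw_cong[THEN iffD1, rotated]) (simp add: p_def)
  then have p: "p permutes X"
    by (rule bij_imp_permutes) (simp add: p_def)
  have E: "equiv X E"
    unfolding E_def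
    by (rule equiv_map_prod_image[OF b])
      (auto intro!: equivI simp: refl_on_def sym_def trans_def)
  have "micro_macro_iso S (system_of e X (p, E))"
    unfolding micro_macro_iso_kernel_iff[OF S system_of_system[OF X(1) p]]
  proof (intro exI[of _ b] conjI ballI)
    show "bij_betw b (micro S) (micro (system_of e X (p, E)))"
      using b by (simp add: system_of_def)
    show "dyn (system_of e X (p, E)) (b x) = b (dyn S x)" if "x \<in> micro S" for x
      using b that by (simp add: system_of_def p_def bij_betw_apply bij_betw_inv_into_left)
    show "proj S x = proj S y \<longleftrightarrow> proj (system_of e X (p, E)) (b x) = proj (system_of e X (p, E)) (b y)"
      if xy: "x \<in> micro S" "y \<in> micro S" for x y
    proof -
      have "(b x, b y) \<in> E \<longleftrightarrow> proj S x = proj S y"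
        unfolding E_def using xy
        by (subst map_prod_image_mem_iff[OF bij_betw_imp_inj_on[OF b]]) auto
      then show ?thesis
        using class_label_eq_iff[OF e E, of "b x" "b y"] xy b by (simp add: system_of_def bij_betw_apply)
    qed
  qed
  then have "micro_macro_iso (system_of e X (p, E)) S"
    using micro_macro_iso_sym[OF S system_of_system[OF X(1) p]] by blast
  with p E show ?thesis
    by blast
qed

theorem theorem9:
  fixes n :: nat
  assumes "n \<ge> 1"
  shows "card ((micro_macro_systems n :: ('x::infinite, 'a::infinite) micro_macro set)
                 // micro_macro_iso_rel n)
       = (\<Sum>k = 1..n. \<Sum>l\<in>par k n. \<Sum>\<pi>\<in>Par k. \<Prod>c\<in>\<pi>. block_sigma l c)"
proof -
  obtain X :: "'x set" where X: "finite X" "card X = n"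
    using infinite_arbitrarily_large[OF infinite_UNIV] by blast
  \<comment> \<open>Classes of relations on \<open>X\<close> are subsets of \<open>X\<close>, so
    \<open>2 ^ n\<close> labels serve all relations at once; infinity of the type provides
    them.\<close>
  obtain A :: "'a set" where A: "finite A" "card A = card (Pow X)"
    using infinite_arbitrarily_large[OF infinite_UNIV] by blast
  obtain e :: "'x set \<Rightarrow> 'a" where "bij_betw e (Pow X) A"
    using finite_same_card_bij[of "Pow X" A] A X(1) by auto
  then have e: "inj_on e (Pow X)"
    by (rule bij_betw_imp_inj_on)
  interpret permutation_action X "perm_equivs X" relabel
    using X(1) by (rule permutation_action_relabel)
  have sys: "system_of e X x \<in> micro_macro_systems n" if "x \<in> perm_equivs X" for x
    using that X system_of_system[of X _ e]
    by (auto simp: perm_equivs_def micro_macro_systems_def) (auto simp: system_of_def)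
  have "card ((micro_macro_systems n :: ('x, 'a) micro_macro set) // micro_macro_iso_rel n)
      = card (perm_equivs X // orbit_rel)"
  proof (rule card_quotient_eqI[OF equiv_micro_macro_iso_rel equiv_orbit_rel sys])
    show "(system_of e X x, system_of e X y) \<in> micro_macro_iso_rel n \<longleftrightarrow> (x, y) \<in> orbit_rel"
      if "x \<in> perm_equivs X" "y \<in> perm_equivs X" for x y
    proof -
      obtain p E q F where xy: "x = (p, E)" "y = (q, F)"
        and pE: "p permutes X" "equiv X E" and qF: "q permutes X" "equiv X F"
        using \<open>x \<in> perm_equivs X\<close> \<open>y \<in> perm_equivs X\<close> by (auto simp: perm_equivs_def)
      show ?thesis
        using sys[OF that(1)] sys[OF that(2)] that(1) system_of_iso_iff[OF X(1) e pE qF]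
        by (simp add: micro_macro_iso_rel_def orbit_rel_def xy)
    qed
    show "\<exists>x\<in>perm_equivs X. (system_of e X x, S) \<in> micro_macro_iso_rel n"
      if S: "S \<in> micro_macro_systems n" for S
    proof -
      obtain p E where "p permutes X" "equiv X E" "micro_macro_iso (system_of e X (p, E)) S"
        using ex_system_of_iso[OF _ X(1) _ e, of S] S X(2) unfolding micro_macro_systems_def by blast
      then show ?thesis
        using S sys[of "(p, E)"] by (auto simp: micro_macro_iso_rel_def perm_equivs_def)
    qed
  qed
  then show ?thesis
    using card_relabel_orbits[OF X assms] by simp
qed

end
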